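(* Let $X$ be a separable real Banach space equipped with a centred nondegenerate Gaussian measure $\gamma$ with Cameron--Martin space $E$. For any $x \in X$ and $r > 0$, $$\frac{\gamma(B_r(x))}{\gamma(B_r(0))} \leq \exp\left(-\min_{h \in E \cap B_r(x)} \frac{1}{2}\|h\|_E^2\right).$$
   Context: $B_r(x)$ denotes the closed ball of radius $r$ centred at $x$ in the norm of $X$. A Borel probability measure $\gamma$ on a separable Banach space $X$ is Gaussian if its pushforward under every $f \in X^*$ is a Gaussian measure on $\mathbb{R}$; it is centred if it has mean zero and nondegenerate if its topological support is all of $X$. Let $X_\gamma^*$ be the closure of $X^*$ in $L^2(\gamma)$, and for $f \in X_\gamma^*$ let $R_\gamma f \in X$ be the element representing the functional $g \mapsto \int_X f(x) g(x)\,\gamma(\mathrm{d}x)$ on $X^*$. The Cameron--Martin space of $\gamma$ is $E = R_\gamma(X_\gamma^* ) \subset X$, a separable Hilbert space with norm $\|h\|_E = \|R_\gamma^{-1} h\|_{L^2(\gamma)}$. *)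

theory Defs
  imports "HOL-Probability.Probability"
begin

(* Dirac measures count as Gaussian (variance zero): the zero functional always pushes
   a measure forward to a Dirac measure. *)
definition real_gaussian :: "real measure \<Rightarrow> bool" where
  "real_gaussian \<nu> \<longleftrightarrow>
     (\<exists>m. \<nu> = return borel m) \<or>
     (\<exists>m s. s > 0 \<and> \<nu> = density lborel (\<lambda>t. ennreal (normal_density m s t)))"

definition gaussian_measure :: "'a::{banach, second_countable_topology} measure \<Rightarrow> bool" where
  "gaussian_measure \<gamma> \<longleftrightarrow>
     prob_space \<gamma> \<and> sets \<gamma> = sets borel \<and>
     (\<forall>f :: 'a \<Rightarrow>\<^sub>L real. real_gaussian (distr \<gamma> borel (blinfun_apply f)))"

(* Mean zero in the weak sense. For a Gaussian measure every f in the dual is integrable, and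
   by Fernique's theorem this agrees with the vanishing of the Bochner mean. *)
definition centred_measure :: "'a::{banach, second_countable_topology} measure \<Rightarrow> bool" where
  "centred_measure \<gamma> \<longleftrightarrow> (\<forall>f :: 'a \<Rightarrow>\<^sub>L real. (LINT x|\<gamma>. f x) = 0)"

definition topological_support :: "'a::topological_space measure \<Rightarrow> 'a set" where
  "topological_support \<gamma> = {x. \<forall>U. open U \<and> x \<in> U \<longrightarrow> emeasure \<gamma> U > 0}"

definition nondegenerate_measure :: "'a::topological_space measure \<Rightarrow> bool" where
  "nondegenerate_measure \<gamma> \<longleftrightarrow> topological_support \<gamma> = UNIV"

definition square_integrable :: "'a measure \<Rightarrow> ('a \<Rightarrow> real) \<Rightarrow> bool" where
  "square_integrable \<gamma> f \<longleftrightarrow>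
     f \<in> borel_measurable \<gamma> \<and> integrable \<gamma> (\<lambda>x. (f x)\<^sup>2)"

definition L2_norm :: "'a measure \<Rightarrow> ('a \<Rightarrow> real) \<Rightarrow> real" where
  "L2_norm \<gamma> f = sqrt (LINT x|\<gamma>. (f x)\<^sup>2)"

(* The closure of the dual in L2. Its elements are functions rather than classes modulo
   almost everywhere equality; the set contains all representatives of each class. *)
definition dual_L2_closure ::
    "'a::{banach, second_countable_topology} measure \<Rightarrow> ('a \<Rightarrow> real) set" where
  "dual_L2_closure \<gamma> =
     {f. square_integrable \<gamma> f \<and>
         (\<forall>e>0. \<exists>g :: 'a \<Rightarrow>\<^sub>L real.
            square_integrable \<gamma> (blinfun_apply g) \<and> L2_norm \<gamma> (\<lambda>x. f x - g x) < e)}"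

(* The operator R_gamma. A representing element is unique by Hahn-Banach; for a Gaussian
   measure and f in the L2-closure of the dual it exists. *)
definition R_op :: "'a::{banach, second_countable_topology} measure \<Rightarrow> ('a \<Rightarrow> real) \<Rightarrow> 'a" where
  "R_op \<gamma> f = (THE h. \<forall>g :: 'a \<Rightarrow>\<^sub>L real. g h = (LINT x|\<gamma>. f x * g x))"

definition cameron_martin_space :: "'a::{banach, second_countable_topology} measure \<Rightarrow> 'a set" where
  "cameron_martin_space \<gamma> = R_op \<gamma> ` dual_L2_closure \<gamma>"

(* inv_into selects one representative of the class of square-integrable functions mapped
   to h. R_op is injective modulo almost everywhere equality, so the norm does not depend
   on the choice. *)
definition cameron_martin_norm :: "'a::{banach, second_countable_topology} measure \<Rightarrow> 'a \<Rightarrow> real" where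
  "cameron_martin_norm \<gamma> h = L2_norm \<gamma> (inv_into (dual_L2_closure \<gamma>) (R_op \<gamma>) h)"

end

theory Submission
  imports Defs
begin

text \<open>
  Let \<open>f\<close> be a functional with standard deviation \<open>\<sigma> > 0\<close> and suppose that \<open>f \<ge> \<rho> \<sigma>\<close> on \<open>B\<^sub>r(x)\<close>.
  Under \<open>\<gamma>\<close>, a random vector is \<open>y + t h\<close> with \<open>h = R f / \<sigma>\<close>, a standard normal \<open>t\<close> and an
  independent Gaussian \<open>y\<close> with \<open>f y = 0\<close>. Shifting \<open>t\<close> by \<open>\<rho>\<close> costs a factor of at most
  \<open>exp (- \<rho>\<^sup>2 / 2)\<close> on the ball, since \<open>t \<ge> \<rho>\<close> there, so \<open>\<gamma>(B\<^sub>r(x)) \<le> exp (- \<rho>\<^sup>2 / 2) \<gamma>(B\<^sub>r(z))\<close>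
  for some \<open>z\<close>, and \<open>\<gamma>(B\<^sub>r(z)) \<le> \<gamma>(B\<^sub>r(0))\<close> by Anderson's inequality. If \<open>\<rho>\<close> is below the least
  Cameron--Martin norm on \<open>B\<^sub>r(x)\<close>, then the Cameron--Martin ball of radius \<open>\<rho>\<close> misses \<open>B\<^sub>r(x)\<close>, and
  Hahn--Banach separation of the two yields such an \<open>f\<close>. The minimum itself is attained by the
  parallelogram law and the completeness of \<open>L\<^sup>2\<close>.
\<close>

section \<open>Separation of convex sets from balls\<close>

text \<open>Since \<open>X\<close> carries no Lebesgue measure, statements about
  \<open>\<gamma>\<close> are reduced to functionals. A finite Borel measure is determined by its
  integrals of \<open>exp (\<i> g)\<close>, so the decomposition along \<open>f\<close> comes down
  to an addition of variances. The same decomposition, used for finitely many functionals in turn,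
  brings Anderson's inequality down to the line: a ball is a countable intersection of slabs, and
  Prekopa--Leindler for the standard normal law is integrated one direction at a time. The exponent
  comes from duality. The largest value of \<open>f\<close> on the Cameron--Martin ball of radius
  \<open>\<rho>\<close> is \<open>\<rho> \<sigma>\<close>, attained at
  \<open>R (\<rho> f / \<sigma>)\<close>. Separation by a functional of norm at most 1 therefore
  gives \<open>f x \<ge> r + \<rho> \<sigma>\<close>, and \<open>f\<close> drops by at most
  \<open>r\<close> between the centre and any point of the ball. Nondegeneracy makes
  \<open>\<sigma>\<close> positive for every nonzero functional, from which it also follows that
  \<open>E\<close> meets every ball, and it keeps the denominator positive.\<close>

definition sublinear :: "('a::real_vector \<Rightarrow> real) \<Rightarrow> bool" where
  "sublinear p \<longleftrightarrow> (\<forall>x y. p (x + y) \<le> p x + p y) \<and> (\<forall>c x. 0 \<le> c \<longrightarrow> p (c *\<^sub>R x) = c * p x)"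

lemma sublinear_add: "sublinear p \<Longrightarrow> p (x + y) \<le> p x + p y"
  by (simp add: sublinear_def)

lemma sublinear_scaleR: "sublinear p \<Longrightarrow> 0 \<le> c \<Longrightarrow> p (c *\<^sub>R x) = c * p x"
  by (simp add: sublinear_def)

lemma sublinear_zero: "sublinear p \<Longrightarrow> p 0 = 0"
  using sublinear_scaleR[of p 0 0] by simp

lemma sublinear_lower: "sublinear p \<Longrightarrow> - p (- x) \<le> p x"
  using sublinear_add[of p x "- x"] sublinear_zero[of p] by simp

text \<open>One inequality for positive scalars is enough: applied to \<open>inverse c\<close> and
  \<open>c *\<^sub>R x\<close> it yields the reverse one.\<close>

lemma sublinearI:
  assumes "\<And>x y. p (x + y) \<le> p x + p y" and "\<And>c x. 0 < c \<Longrightarrow> p (c *\<^sub>R x) \<le> c * p x" and "p 0 = 0"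
  shows "sublinear p"
  unfolding sublinear_def
proof (intro conjI allI impI)
  fix c :: real and x assume c: "0 \<le> c"
  show "p (c *\<^sub>R x) = c * p x"
  proof (cases "c = 0")
    case False
    with c have c: "c > 0" by simp
    have "p (inverse c *\<^sub>R (c *\<^sub>R x)) \<le> inverse c * p (c *\<^sub>R x)"
      by (rule assms(2)) (use c in simp)
    then have "c * p x \<le> p (c *\<^sub>R x)" using c by (simp add: field_simps)
    with assms(2)[OF c, of x] show ?thesis by simp
  qed (simp add: assms)
qed (rule assms(1))

text \<open>The functional built here is the largest possible one: any sublinear \<open>p'\<close>
  below \<open>q\<close> with \<open>p' (- d) \<le> - s\<close> satisfies
  \<open>p' y \<le> p' (y + t d) + t p' (- d) \<le> q (y + t d) - t s\<close>, and \<open>p\<close>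
  is the infimum of these bounds. It is used for singletons to show that minimal functionals are
  linear, and for \<open>q = norm\<close> to separate.\<close>

lemma sublinear_lower_on_convex:
  assumes q: "sublinear q" and D: "convex D" "D \<noteq> {}" and qD: "\<And>d. d \<in> D \<Longrightarrow> s \<le> q d"
  obtains p where "sublinear p" "\<And>y. p y \<le> q y" "\<And>d. d \<in> D \<Longrightarrow> p (- d) \<le> - s"
proof -
  define V where "V y = (\<lambda>(t, d). q (y + t *\<^sub>R d) - t * s) ` ({0..} \<times> D)" for y
  define p where "p y = Inf (V y)" for y
  have ne: "V y \<noteq> {}" for y using D unfolding V_def by auto
  \<comment> \<open>The bound \<open>s \<le> q d\<close> on \<open>D\<close> keeps the infimum
    finite: \<open>t s \<le> q (t d) \<le> q (y + t d) + q (- y)\<close>.\<close>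
  have lb: "- q (- y) \<le> v" if v: "v \<in> V y" for v y
  proof -
    from v obtain t d where td: "t \<ge> 0" "d \<in> D" "v = q (y + t *\<^sub>R d) - t * s"
      unfolding V_def by auto
    have "q (t *\<^sub>R d) \<le> q (y + t *\<^sub>R d) + q (- y)"
      using sublinear_add[OF q, of "y + t *\<^sub>R d" "- y"] by simp
    moreover have "t * s \<le> q (t *\<^sub>R d)"
      using td qD[of d] by (simp add: sublinear_scaleR[OF q] mult_left_mono)
    ultimately show ?thesis using td by simp
  qed
  have bdd: "bdd_below (V y)" for y using lb by (intro bdd_belowI) auto
  have le: "p y \<le> q (y + t *\<^sub>R d) - t * s" if "t \<ge> 0" "d \<in> D" for y t d
    unfolding p_def by (rule cInf_lower[OF _ bdd]) (use that in \<open>auto simp: V_def intro!: image_eqI[of _ _ "(t, d)"]\<close>)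
  obtain d0 where d0: "d0 \<in> D" using D by auto
  have pq: "p y \<le> q y" for y using le[of 0 d0 y] d0 by simp
  have "sublinear p"
  proof (rule sublinearI)
    fix x y
    have "p (x + y) - v \<le> p x" if v: "v \<in> V y" for v
      unfolding p_def[of x]
    proof (rule cInf_greatest[OF ne])
      fix u assume "u \<in> V x"
      then obtain t d where td: "t \<ge> 0" "d \<in> D" "u = q (x + t *\<^sub>R d) - t * s"
        unfolding V_def by auto
      from v obtain t' d' where td': "t' \<ge> 0" "d' \<in> D" "v = q (y + t' *\<^sub>R d') - t' * s"
        unfolding V_def by auto
      \<comment> \<open>Convexity enters here: two scaled points of \<open>D\<close> add up to one
        point of \<open>D\<close> scaled by the sum of the factors, so a bound for \<open>x\<close>
        and a bound for \<open>y\<close> combine into a bound for \<open>x + y\<close>.\<close>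
      have "\<exists>e\<in>D. (t + t') *\<^sub>R e = t *\<^sub>R d + t' *\<^sub>R d'"
      proof (cases "t + t' = 0")
        case True
        with td td' have "t = 0" "t' = 0" by auto
        then show ?thesis using d0 by auto
      next
        case False
        with td td' have pos: "t + t' > 0" by simp
        have "(t / (t + t')) *\<^sub>R d + (t' / (t + t')) *\<^sub>R d' \<in> D"
          by (rule convexD[OF D(1)]) (use td td' pos in \<open>auto simp: add_divide_distrib[symmetric]\<close>)
        moreover have "(t + t') *\<^sub>R ((t / (t + t')) *\<^sub>R d + (t' / (t + t')) *\<^sub>R d') = t *\<^sub>R d + t' *\<^sub>R d'"
          using False by (simp add: scaleR_add_right)
        ultimately show ?thesis by blast
      qed
      then obtain e where e: "e \<in> D" "(t + t') *\<^sub>R e = t *\<^sub>R d + t' *\<^sub>R d'" by blast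
      have "p (x + y) \<le> q ((x + y) + (t + t') *\<^sub>R e) - (t + t') * s"
        by (rule le) (use td td' e in auto)
      also have "(x + y) + (t + t') *\<^sub>R e = (x + t *\<^sub>R d) + (y + t' *\<^sub>R d')"
        using e by simp
      also have "q \<dots> \<le> q (x + t *\<^sub>R d) + q (y + t' *\<^sub>R d')" by (rule sublinear_add[OF q])
      finally show "p (x + y) - v \<le> u" using td td' by (simp add: algebra_simps)
    qed
    then have "p (x + y) - p x \<le> v" if "v \<in> V y" for v using that by fastforce
    then have "p (x + y) - p x \<le> p y" unfolding p_def[of y] by (rule cInf_greatest[OF ne])
    then show "p (x + y) \<le> p x + p y" by simp
  next
    fix c :: real and x assume c: "0 < c"
    have "p (c *\<^sub>R x) / c \<le> p x" unfolding p_def[of x]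
    proof (rule cInf_greatest[OF ne])
      fix u assume "u \<in> V x"
      then obtain t d where td: "t \<ge> 0" "d \<in> D" "u = q (x + t *\<^sub>R d) - t * s"
        unfolding V_def by auto
      have "p (c *\<^sub>R x) \<le> q (c *\<^sub>R x + (c * t) *\<^sub>R d) - (c * t) * s"
        by (rule le) (use td c in auto)
      also have "c *\<^sub>R x + (c * t) *\<^sub>R d = c *\<^sub>R (x + t *\<^sub>R d)" by (simp add: algebra_simps)
      also have "q \<dots> = c * q (x + t *\<^sub>R d)" using c by (simp add: sublinear_scaleR[OF q])
      finally have "p (c *\<^sub>R x) \<le> c * u" using arg_cong[OF td(3), of "\<lambda>z. c * z"] by (simp add: algebra_simps)
      then show "p (c *\<^sub>R x) / c \<le> u" using c by (simp add: field_simps)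
    qed
    then show "p (c *\<^sub>R x) \<le> c * p x" using c by (simp add: field_simps)
  next
    have "0 \<le> p 0" unfolding p_def using lb[of _ 0] by (intro cInf_greatest[OF ne]) (auto simp: sublinear_zero[OF q])
    then show "p 0 = 0" using pq[of 0] by (simp add: sublinear_zero[OF q])
  qed
  moreover have "p (- d) \<le> - s" if "d \<in> D" for d
    using le[of 1 d "- d"] that by (simp add: sublinear_zero[OF q])
  ultimately show thesis using pq that by blast
qed

text \<open>An infimum of sublinear functionals need not be subadditive in general. In a chain any
  two members lie above the smaller one of them, whose subadditivity passes to the infimum. The
  bound \<open>b\<close> keeps the infimum finite.\<close>

lemma sublinear_chain_Inf:
  assumes "C \<noteq> {}" and sub: "\<And>p. p \<in> C \<Longrightarrow> sublinear p"
    and chain: "\<And>p q. p \<in> C \<Longrightarrow> q \<in> C \<Longrightarrow> p \<le> q \<or> q \<le> p"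
    and lower: "\<And>p x. p \<in> C \<Longrightarrow> b x \<le> p x"
  shows "sublinear (\<lambda>x. INF p\<in>C. p x)" and "\<And>p. p \<in> C \<Longrightarrow> (\<lambda>x. INF p\<in>C. p x) \<le> p"
proof -
  have bdd: "bdd_below ((\<lambda>p. p x) ` C)" for x
    using lower by (intro bdd_belowI[of _ "b x"]) auto
  have le: "(INF p\<in>C. p x) \<le> p x" if "p \<in> C" for p x
    using cINF_lower[OF bdd that] .
  then show "\<And>p. p \<in> C \<Longrightarrow> (\<lambda>x. INF p\<in>C. p x) \<le> p" by (simp add: le_fun_def)
  show "sublinear (\<lambda>x. INF p\<in>C. p x)"
  proof (rule sublinearI)
    fix x y
    have *: "(INF p\<in>C. p (x + y)) - q y \<le> r x" if qr: "q \<in> C" "r \<in> C" for q r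
    proof -
      obtain m where m: "m \<in> C" "m \<le> q" "m \<le> r" using chain[OF qr] qr by blast
      have "(INF p\<in>C. p (x + y)) \<le> m (x + y)" by (rule le[OF m(1)])
      also have "\<dots> \<le> m x + m y" by (rule sublinear_add[OF sub[OF m(1)]])
      also have "\<dots> \<le> r x + q y" using m by (intro add_mono) (auto simp: le_fun_def)
      finally show ?thesis by simp
    qed
    have "(INF p\<in>C. p (x + y)) - q y \<le> (INF p\<in>C. p x)" if "q \<in> C" for q
      by (rule cINF_greatest[OF assms(1)]) (rule *[OF that])
    then have "(INF p\<in>C. p (x + y)) - (INF p\<in>C. p x) \<le> (INF p\<in>C. p y)"
      by (intro cINF_greatest[OF assms(1)]) (simp add: algebra_simps)
    then show "(INF p\<in>C. p (x + y)) \<le> (INF p\<in>C. p x) + (INF p\<in>C. p y)" by simp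
  next
    fix c :: real and x assume c: "0 < c"
    have "(INF p\<in>C. p (c *\<^sub>R x)) / c \<le> (INF p\<in>C. p x)"
    proof (rule cINF_greatest[OF assms(1)])
      fix q assume q: "q \<in> C"
      have "(INF p\<in>C. p (c *\<^sub>R x)) \<le> c * q x"
        using le[OF q, of "c *\<^sub>R x"] c by (simp add: sublinear_scaleR[OF sub[OF q]])
      then show "(INF p\<in>C. p (c *\<^sub>R x)) / c \<le> q x" using c by (simp add: field_simps)
    qed
    then show "(INF p\<in>C. p (c *\<^sub>R x)) \<le> c * (INF p\<in>C. p x)" using c by (simp add: field_simps)
  next
    show "(INF p\<in>C. p 0) = 0"
      using assms(1) by (simp add: sublinear_zero sub cong: INF_cong_simp)
  qed
qed

text \<open>A sublinear functional that is minimal in the pointwise order is linear, so Zorn's lemma applied to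
  sublinear functionals gives the Hahn--Banach theorem without extending from subspaces.\<close>

lemma sublinear_dominates_linear:
  fixes p :: "'a::real_vector \<Rightarrow> real"
  assumes p: "sublinear p"
  obtains L where "linear L" "\<And>x. L x \<le> p x"
proof -
  define S where "S = {q. sublinear q \<and> q \<le> p}"
  have lower: "- p (- x) \<le> q x" if "q \<in> S" for q x
    using sublinear_lower[of q x] that unfolding S_def le_fun_def by (smt (verit) mem_Collect_eq)
  have "\<exists>m\<in>S. \<forall>a\<in>S. a \<le> m \<longrightarrow> a = m"
  \<comment> \<open>The order is reversed, so that the maximal element of Zorn's lemma is a minimal
    sublinear functional.\<close>
  proof (rule predicate_Zorn[where P = "\<lambda>x y. y \<le> x" and A = S, simplified])
    show "partial_order_on S (relation_of (\<lambda>x y. y \<le> x) S)"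
      by (rule partial_order_on_relation_ofI) auto
    fix C assume C: "C \<in> Chains (relation_of (\<lambda>x y. y \<le> x) S)"
    show "\<exists>u\<in>S. \<forall>a\<in>C. u \<le> a"
    proof (cases "C = {}")
      case True
      then show ?thesis using p unfolding S_def by auto
    next
      case False
      have CS: "C \<subseteq> S" and ch: "\<And>a b. a \<in> C \<Longrightarrow> b \<in> C \<Longrightarrow> a \<le> b \<or> b \<le> a"
        using C unfolding Chains_def relation_of_def by auto
      let ?u = "\<lambda>x. INF q\<in>C. q x"
      have "sublinear ?u" and ub: "\<And>q. q \<in> C \<Longrightarrow> ?u \<le> q"
        using sublinear_chain_Inf[of C "\<lambda>x. - p (- x)"] False CS ch lower
        unfolding S_def by blast+
      moreover have "?u \<le> p"
      proof -
        obtain q where "q \<in> C" using False by auto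
        then have "?u \<le> q" "q \<le> p" using ub CS unfolding S_def by auto
        then show ?thesis by (rule order_trans)
      qed
      ultimately show ?thesis unfolding S_def by blast
    qed
  qed
  then obtain m where m: "m \<in> S" "\<And>a. a \<in> S \<Longrightarrow> a \<le> m \<Longrightarrow> a = m" by blast
  have sm: "sublinear m" and mp: "m \<le> p" using m unfolding S_def by auto
  \<comment> \<open>Minimality forces oddness: lowering \<open>m\<close> on the singleton
    \<open>{z}\<close> gives a sublinear \<open>q\<close> below \<open>m\<close> with
    \<open>q (- z) \<le> - m z\<close>, and \<open>q\<close> has to be \<open>m\<close>. The reverse
    inequality holds for every sublinear functional.\<close>
  have neg: "m (- z) = - m z" for z
  proof -
    obtain q where q: "sublinear q" "\<And>y. q y \<le> m y" "q (- z) \<le> - m z"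
      using sublinear_lower_on_convex[OF sm, of "{z}" "m z"] by auto
    then have "q = m" using mp by (intro m(2)) (auto simp: S_def le_fun_def intro: order_trans)
    then show ?thesis using q sublinear_lower[OF sm, of "z"] by simp
  qed
  have "linear m"
  proof (rule linearI)
    fix x y
    \<comment> \<open>For an odd functional, subadditivity at \<open>- x\<close> and
      \<open>- y\<close> is superadditivity at \<open>x\<close> and \<open>y\<close>.\<close>
    have "m (- x + - y) \<le> m (- x) + m (- y)" by (rule sublinear_add[OF sm])
    then show "m (x + y) = m x + m y"
      using sublinear_add[OF sm, of x y] neg[of "x + y"] neg[of x] neg[of y] by simp
  next
    fix c :: real and x
    show "m (c *\<^sub>R x) = c *\<^sub>R m x"
    proof (cases "c \<ge> 0")
      case True then show ?thesis by (simp add: sublinear_scaleR[OF sm])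
    next
      case False
      then show ?thesis
        using sublinear_scaleR[OF sm, of "- c" x] neg[of "c *\<^sub>R x"] by simp
    qed
  qed
  then show thesis using that mp by (auto simp: le_fun_def)
qed

lemma sublinear_norm: "sublinear norm"
  by (simp add: sublinear_def norm_triangle_ineq)

text \<open>A linear \<open>L\<close> below \<open>p\<close> satisfies
  \<open>L d = - L (- d) \<ge> - p (- d) \<ge> s\<close>, and \<open>p \<le> norm\<close> bounds its
  norm by 1.\<close>

theorem separate_convex_from_ball:
  fixes D :: "'a::real_normed_vector set"
  assumes "convex D" "D \<noteq> {}" "\<And>d. d \<in> D \<Longrightarrow> s \<le> norm d"
  obtains L :: "'a \<Rightarrow>\<^sub>L real" where "norm L \<le> 1" "\<And>d. d \<in> D \<Longrightarrow> s \<le> L d"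
proof -
  obtain p :: "'a \<Rightarrow> real" where p: "sublinear p" "\<And>y. p y \<le> norm y" "\<And>d. d \<in> D \<Longrightarrow> p (- d) \<le> - s"
    using sublinear_lower_on_convex[OF sublinear_norm assms] by blast
  obtain L where L: "linear L" "\<And>x. L x \<le> p x"
    using sublinear_dominates_linear[OF p(1)] by blast
  have le: "\<bar>L x\<bar> \<le> norm x" for x
    using L(2)[of x] L(2)[of "- x"] p(2)[of x] p(2)[of "- x"] linear_neg[OF L(1), of x] by simp
  have bl: "bounded_linear L"
    using L(1) le by (intro bounded_linear_intro[where K = 1]) (auto simp: linear_add linear_scale)
  have "norm (Blinfun L) \<le> 1"
    by (rule norm_blinfun_bound) (use le in \<open>simp_all add: bounded_linear_Blinfun_apply[OF bl]\<close>)
  moreover have "s \<le> Blinfun L d" if "d \<in> D" for d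
    using L(2)[of "- d"] p(3)[OF that] linear_neg[OF L(1), of d]
    by (simp add: bounded_linear_Blinfun_apply[OF bl])
  ultimately show thesis using that by blast
qed

corollary norming_functional:
  fixes z :: "'a::real_normed_vector"
  obtains L :: "'a \<Rightarrow>\<^sub>L real" where "norm L \<le> 1" "L z = norm z"
proof -
  obtain L :: "'a \<Rightarrow>\<^sub>L real" where L: "norm L \<le> 1" "norm z \<le> L z"
    using separate_convex_from_ball[of "{z}" "norm z"] by auto
  have "L z \<le> norm L * norm z" using norm_blinfun[of L z] by simp
  also have "\<dots> \<le> norm z" using mult_right_mono[OF L(1), of "norm z"] by simp
  finally show thesis using L that by simp
qed

corollary functionals_separate_points:
  fixes x y :: "'a::real_normed_vector"
  assumes "\<And>g :: 'a \<Rightarrow>\<^sub>L real. g x = g y"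
  shows "x = y"
proof -
  obtain L :: "'a \<Rightarrow>\<^sub>L real" where "L (x - y) = norm (x - y)" using norming_functional by blast
  then show ?thesis using assms[of L] by (simp add: blinfun.diff_right)
qed

section \<open>Measures are determined by their characteristic functional\<close>

text \<open>Norming functionals for a countable dense set norm all points by approximation, because
  each has norm at most 1. The equivalence turns a closed ball into a countable intersection of
  slabs, both for generating the Borel sets and for Anderson's inequality.\<close>

lemma countable_norming_family:
  obtains f :: "nat \<Rightarrow> ('a::{real_normed_vector, second_countable_topology} \<Rightarrow>\<^sub>L real)"
  where "\<And>y r. norm y \<le> r \<longleftrightarrow> (\<forall>i. \<bar>f i y\<bar> \<le> r)"
proof -
  obtain D :: "'a set" where D: "countable D" "\<And>U. open U \<Longrightarrow> U \<noteq> {} \<Longrightarrow> \<exists>d\<in>D. d \<in> U"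
    using countable_dense_setE by blast
  have ne: "D \<noteq> {}" using D(2)[of UNIV] by auto
  have "\<exists>L :: 'a \<Rightarrow>\<^sub>L real. norm L \<le> 1 \<and> blinfun_apply L (from_nat_into D i) = norm (from_nat_into D i)" for i
    using norming_functional by blast
  then obtain f :: "nat \<Rightarrow> ('a \<Rightarrow>\<^sub>L real)" where f: "\<And>i. norm (f i) \<le> 1"
      "\<And>i. f i (from_nat_into D i) = norm (from_nat_into D i)"
    by metis
  have le: "\<bar>f i y\<bar> \<le> norm y" for i y
    using norm_blinfun[of "f i" y] mult_right_mono[OF f(1)[of i], of "norm y"] by simp
  have "norm y \<le> r" if y: "\<forall>i. \<bar>f i y\<bar> \<le> r" for y r
  proof (rule field_le_epsilon)
    fix e :: real assume e: "0 < e"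
    obtain d where d: "d \<in> D" "dist y d < e / 2"
      using D(2)[of "ball y (e / 2)"] e by auto
    obtain i where i: "d = from_nat_into D i" using from_nat_into_surj[OF D(1) d(1)] by metis
    have "norm y \<le> norm d + norm (y - d)" using norm_triangle_ineq[of d "y - d"] by simp
    also have "norm d = f i y - f i (y - d)" using f(2)[of i] i by (simp add: blinfun.diff_right)
    finally show "norm y \<le> r + e" using y[rule_format, of i] le[of i "y - d"] d(2)
      by (simp add: dist_norm)
  qed
  then show thesis using that le order_trans by metis
qed

lemma blinfun_apply_borel_measurable [measurable]: "blinfun_apply f \<in> borel_measurable borel"
  by (intro borel_measurable_continuous_onI continuous_intros)

text \<open>Conditions form a list so that an induction can add them one at a time; concatenation
  gives intersections and the empty list gives the whole space.\<close>

definition cylinder :: "(('a::real_normed_vector \<Rightarrow>\<^sub>L real) \<times> real set) list \<Rightarrow> 'a set" where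
  "cylinder ps = {y. \<forall>(f, A) \<in> set ps. blinfun_apply f y \<in> A}"

definition cylinders :: "'a::real_normed_vector set set" where
  "cylinders = {cylinder ps | ps. \<forall>(f, A) \<in> set ps. A \<in> sets borel}"

lemma cylinder_Cons: "cylinder ((f, A) # ps) = cylinder ps \<inter> {y. f y \<in> A}"
  by (auto simp: cylinder_def)

lemma cylinder_measurable:
  fixes ps :: "(('a::real_normed_vector \<Rightarrow>\<^sub>L real) \<times> real set) list"
  assumes "\<forall>(f, A) \<in> set ps. A \<in> sets borel"
  shows "cylinder ps \<in> sets borel"
  using assms
proof (induction ps)
  case (Cons a ps)
  obtain f A where a: "a = (f, A)" by (cases a)
  have "blinfun_apply f -` A \<inter> space borel \<in> sets borel"
    using Cons.prems a by (intro measurable_sets[of _ borel borel]) auto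
  then have "{y. f y \<in> A} \<in> sets borel" by (simp add: vimage_def)
  with Cons a show ?case by (auto simp: cylinder_Cons)
qed (simp add: cylinder_def)

text \<open>By the norming family a closed ball is a countable intersection of cylinders, and by
  separability an open set is a countable union of closed balls with centres in a dense set and
  rational radii.\<close>

lemma sigma_sets_cylinders:
  "sigma_sets UNIV cylinders = sets (borel :: 'a::{real_normed_vector, second_countable_topology} measure)"
proof
  show "sigma_sets UNIV (cylinders :: 'a set set) \<subseteq> sets borel"
    using sets.sigma_sets_subset[of cylinders borel] cylinder_measurable by (auto simp: cylinders_def)
next
  interpret S: sigma_algebra UNIV "sigma_sets UNIV (cylinders :: 'a set set)"
    by (rule sigma_algebra_sigma_sets) simp
  obtain f :: "nat \<Rightarrow> ('a \<Rightarrow>\<^sub>L real)" where f: "\<And>y r. norm y \<le> r \<longleftrightarrow> (\<forall>i. \<bar>f i y\<bar> \<le> r)"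
    using countable_norming_family by blast
  have ball: "cball z r \<in> sigma_sets UNIV cylinders" for z :: 'a and r
  proof -
    have "cball z r = (\<Inter>i. cylinder [(f i, {f i z - r .. f i z + r})])"
      by (auto simp: cylinder_def dist_norm norm_minus_commute[of z] f blinfun.diff_right abs_le_iff algebra_simps)
    also have "\<dots> \<in> sigma_sets UNIV cylinders"
      by (intro S.countable_INT) (auto simp: cylinders_def intro!: sigma_sets.Basic exI[of _ "[_]"])
    finally show ?thesis .
  qed
  obtain D :: "'a set" where D: "countable D" "\<And>U. open U \<Longrightarrow> U \<noteq> {} \<Longrightarrow> \<exists>d\<in>D. d \<in> U"
    using countable_dense_setE by blast
  have "U \<in> sigma_sets UNIV cylinders" if U: "open U" for U :: "'a set"
  proof -
    have "U = (\<Union>(d, q) \<in> {(d, q) \<in> D \<times> \<rat>. cball d q \<subseteq> U}. cball d q)"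
    proof (intro equalityI subsetI)
      fix y assume "y \<in> U"
      then obtain e where e: "e > 0" "cball y e \<subseteq> U" using U open_contains_cball by blast
      obtain q where q: "q \<in> \<rat>" "0 < q" "q < e / 2" using Rats_dense_in_real[of 0 "e / 2"] e by auto
      obtain d where d: "d \<in> D" "dist y d < q"
        using D(2)[of "ball y q"] q by auto
      have "cball d q \<subseteq> cball y e"
        using d q by (intro subsetI) (auto intro: order_trans[OF dist_triangle[of _ _ d]])
      then have "(d, q) \<in> {(d, q) \<in> D \<times> \<rat>. cball d q \<subseteq> U}" using d q e by auto
      moreover have "y \<in> cball d q" using d by (simp add: dist_commute)
      ultimately show "y \<in> (\<Union>(d, q) \<in> {(d, q) \<in> D \<times> \<rat>. cball d q \<subseteq> U}. cball d q)" by blast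
    qed auto
    also have "\<dots> \<in> sigma_sets UNIV cylinders"
    proof (rule S.countable_UN')
      have "countable (D \<times> \<rat>)" using D(1) countable_rat by blast
      then show "countable {(d, q) \<in> D \<times> \<rat>. cball d q \<subseteq> U}" by (rule countable_subset[rotated]) auto
    qed (use ball in auto)
    finally show ?thesis .
  qed
  then have "sigma_sets UNIV {U :: 'a set. open U} \<subseteq> sigma_sets UNIV cylinders"
    by (intro S.sigma_sets_subset) auto
  then show "sets borel \<subseteq> sigma_sets UNIV (cylinders :: 'a set set)"
    by (simp add: borel_def)
qed

lemma Int_stable_cylinders: "Int_stable cylinders"
proof (rule Int_stableI)
  fix a b :: "'a set" assume "a \<in> cylinders" "b \<in> cylinders"
  then obtain p q where "a = cylinder p" "b = cylinder q"
    "\<forall>(f, A) \<in> set p. A \<in> sets borel" "\<forall>(f, A) \<in> set q. A \<in> sets borel"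
    unfolding cylinders_def by blast
  then show "a \<inter> b \<in> cylinders"
    unfolding cylinders_def by (intro CollectI exI[of _ "p @ q"]) (auto simp: cylinder_def)
qed

text \<open>After normalisation, the images under \<open>f\<close> of the two measures with density
  \<open>w\<close> are probability measures on the line with the same characteristic function, so
  Levy's uniqueness theorem applies.\<close>

lemma weighted_char_unique:
  fixes \<mu> \<nu> :: "'a measure" and w f :: "'a \<Rightarrow> real"
  assumes "finite_measure \<mu>" "finite_measure \<nu>"
    and [measurable]: "w \<in> borel_measurable \<mu>" "w \<in> borel_measurable \<nu>" "f \<in> borel_measurable \<mu>" "f \<in> borel_measurable \<nu>"
    and w: "\<And>y. 0 \<le> w y" "\<And>y. w y \<le> B"
    and char: "\<And>t. (CLINT y|\<mu>. w y * iexp (t * f y)) = (CLINT y|\<nu>. w y * iexp (t * f y))"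
    and A: "A \<in> sets borel"
  shows "(LINT y|\<mu>. w y * indicator A (f y)) = (LINT y|\<nu>. w y * indicator A (f y))"
proof -
  define c where "c = (LINT y|\<mu>. w y)"
  \<comment> \<open>The hypothesis at \<open>t = 0\<close> says that the total masses agree, so one
    constant normalises both sides.\<close>
  have c2: "c = (LINT y|\<nu>. w y)" using char[of 0] unfolding c_def by simp
  have c0: "c \<ge> 0" unfolding c_def using w by simp
  note [measurable] = A
  \<comment> \<open>A mass of zero cannot be normalised, but then \<open>w\<close> vanishes almost
    everywhere and so do both integrals.\<close>
  have vanish: "(LINT y|M. w y * indicator A (f y)) = 0"
    if M: "finite_measure M" "w \<in> borel_measurable M" "(LINT y|M. w y) = 0" for M
  proof -
    interpret finite_measure M by fact
    have "integrable M w" using w M by (intro integrable_const_bound[where B = B]) auto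
    then have "AE y in M. w y = 0" using M w integral_nonneg_eq_0_iff_AE[of M w] by simp
    then have "AE y in M. w y * indicator A (f y) = 0" by eventually_elim simp
    then show ?thesis by (rule integral_eq_zero_AE)
  qed
  show ?thesis
  proof (cases "c = 0")
    case True
    then show ?thesis using vanish[of \<mu>] vanish[of \<nu>] assms c_def c2 by simp
  next
    case False
    then have c: "c > 0" using c0 by simp
    define N where "N M = distr (density M (\<lambda>y. ennreal (w y / c))) borel f" for M
    have *: "real_distribution (N M) \<and> (\<forall>t. char (N M) t = (CLINT y|M. w y * iexp (t * f y)) / c)
        \<and> measure (N M) A = (LINT y|M. w y * indicator A (f y)) / c"
      if M: "finite_measure M" and [measurable]: "w \<in> borel_measurable M" "f \<in> borel_measurable M"
        and cM: "c = (LINT y|M. w y)" for M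
    proof (intro conjI allI)
      interpret finite_measure M by fact
      have int: "integrable M w" using w by (intro integrable_const_bound[where B = B]) auto
      have "prob_space (density M (\<lambda>y. ennreal (w y / c)))"
      proof
        have "emeasure (density M (\<lambda>y. ennreal (w y / c))) (space M) = (\<integral>\<^sup>+y. ennreal (w y / c) \<partial>M)"
          by (subst emeasure_density) (auto intro!: nn_integral_cong)
        also have "\<dots> = ennreal (LINT y|M. w y / c)"
          by (rule nn_integral_eq_integral) (use int w c in auto)
        also have "\<dots> = 1" using c cM by simp
        finally show "emeasure (density M (\<lambda>y. ennreal (w y / c))) (space (density M (\<lambda>y. ennreal (w y / c)))) = 1"
          by simp
      qed
      then interpret P: prob_space "density M (\<lambda>y. ennreal (w y / c))" .
      show rd: "real_distribution (N M)"
        unfolding N_def by (rule P.real_distribution_distr) simp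
      show "char (N M) t = (CLINT y|M. w y * iexp (t * f y)) / c" for t
      proof -
        have "char (N M) t = (CLINT y|M. (w y / c) *\<^sub>R iexp (t * f y))"
          unfolding char_def N_def
          by (subst integral_distr) (simp, simp, subst integral_density, use w c in auto)
        also have "\<dots> = (CLINT y|M. w y * iexp (t * f y) / c)" by (simp add: scaleR_conv_of_real)
        finally show ?thesis by simp
      qed
      interpret R: real_distribution "N M" by fact
      have "measure (N M) A = (LINT y|N M. indicator A y)" by simp
      also have "\<dots> = (LINT y|M. (w y / c) *\<^sub>R indicator A (f y))"
        unfolding N_def
        by (subst integral_distr) (simp, simp, subst integral_density, use w c in auto)
      also have "\<dots> = (LINT y|M. w y * indicator A (f y) / c)" by simp
      finally show "measure (N M) A = (LINT y|M. w y * indicator A (f y)) / c" by simp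
    qed
    have "N \<mu> = N \<nu>"
      using *[of \<mu>] *[of \<nu>] assms c_def c2 by (intro Levy_uniqueness) auto
    then show ?thesis using *[of \<mu>] *[of \<nu>] assms c_def c2 c by simp
  qed
qed

lemma iexp_eq_cos_sin: "iexp a = complex_of_real (cos a) + \<i> * complex_of_real (sin a)"
  by (simp add: exp_Euler cos_of_real sin_of_real)

text \<open>A new condition \<open>f y \<in> A\<close> is added through the one-dimensional uniqueness theorem for the law of
  \<open>f\<close> under a finite measure. The weights \<open>1 + cos g\<close> and \<open>1 + sin g\<close> replace \<open>exp (\<i> g)\<close> because
  that theorem needs nonnegative densities.\<close>

lemma char_unique_on_cylinders:
  fixes \<mu> \<nu> :: "'a::real_normed_vector measure"
  assumes "finite_measure \<mu>" "finite_measure \<nu>" and [measurable_cong]: "sets \<mu> = sets borel" "sets \<nu> = sets borel"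
    and char: "\<And>g :: 'a \<Rightarrow>\<^sub>L real. (CLINT y|\<mu>. iexp (g y)) = (CLINT y|\<nu>. iexp (g y))"
    and ps: "\<forall>(f, A) \<in> set ps. A \<in> sets borel"
  shows "(CLINT y|\<mu>. indicator (cylinder ps) y * iexp (blinfun_apply g y)) = (CLINT y|\<nu>. indicator (cylinder ps) y * iexp (blinfun_apply g y))"
  using ps
proof (induction ps arbitrary: g)
  case Nil
  then show ?case using char by (simp add: cylinder_def)
next
  case (Cons a ps)
  obtain f A where a: "a = (f, A)" by (cases a)
  have [measurable]: "A \<in> sets borel" and S[measurable]: "cylinder ps \<in> sets borel"
    using Cons.prems a by (auto intro!: cylinder_measurable)
  let ?S = "cylinder ps"
  have int: "integrable M (\<lambda>y. indicator ?S y * iexp (blinfun_apply k y))"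
    if M: "finite_measure M" and [measurable_cong]: "sets M = sets borel" for M k
  proof -
    interpret finite_measure M by fact
    show ?thesis by (rule integrable_const_bound[where B = 1]) (auto simp: norm_mult split: split_indicator)
  qed
  have eqS: "(CLINT y|\<mu>. indicator ?S y * iexp (blinfun_apply k y)) = (CLINT y|\<nu>. indicator ?S y * iexp (blinfun_apply k y))" for k
    using Cons by simp
  define J where "J k = (CLINT y|\<nu>. indicator ?S y * iexp (blinfun_apply k y))" for k
  have lin: "(CLINT y|M. a * (indicator ?S y * iexp (blinfun_apply k y)) + b * (indicator ?S y * iexp (blinfun_apply l y)) + d * (indicator ?S y * iexp (blinfun_apply m y))) 
      = a * J k + b * J l + d * J m" if M: "M = \<mu> \<or> M = \<nu>" for M k l m and a b d :: complex
  proof -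
    have i: "integrable M (\<lambda>y. indicator ?S y * iexp (blinfun_apply k y))" for k
      using M int assms by blast
    have "(CLINT y|M. indicator ?S y * iexp (blinfun_apply k y)) = J k" for k
      using M eqS unfolding J_def by auto
    then show ?thesis using i by simp
  qed
  \<comment> \<open>Each weight is the indicator of the shorter cylinder times a combination of 1,
    \<open>exp (\<i> g)\<close> and \<open>exp (- \<i> g)\<close>. Multiplied by
    \<open>iexp (t * f y)\<close> it involves only the exponentials of \<open>t f\<close>,
    \<open>t f + g\<close> and \<open>t f - g\<close>, for which the induction hypothesis is
    available since \<open>g\<close> is arbitrary in it.\<close>
  have comb: "(LINT y|\<mu>. w y * indicator A (f y)) = (LINT y|\<nu>. w y * indicator A (f y))"
    if w[measurable]: "w \<in> borel_measurable borel" and b: "\<And>y. 0 \<le> w y" "\<And>y. w y \<le> 2"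
      and wJ: "\<And>t y. complex_of_real (w y) * iexp (t * f y) = 1 * (indicator ?S y * iexp (blinfun_apply (t *\<^sub>R f) y))
           + b * (indicator ?S y * iexp (blinfun_apply (t *\<^sub>R f + g) y)) + d * (indicator ?S y * iexp (blinfun_apply (t *\<^sub>R f - g) y))"
    for w b d
  proof (rule weighted_char_unique[where B = 2])
    fix t show "(CLINT y|\<mu>. complex_of_real (w y) * iexp (t * blinfun_apply f y)) = (CLINT y|\<nu>. complex_of_real (w y) * iexp (t * blinfun_apply f y))"
      unfolding wJ by (simp only: lin simp_thms)
  qed (use assms b in auto)
  have 1: "(LINT y|\<mu>. indicator ?S y * indicator A (f y)) = (LINT y|\<nu>. indicator ?S y * (indicator A (f y) :: real))"
    by (rule comb[where b = 0 and d = 0]) (auto split: split_indicator simp: blinfun.bilinear_simps)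
  have e1: "complex_of_real (cos a) = (1/2) * iexp a + (1/2) * iexp (- a)" for a
    by (simp only: iexp_eq_cos_sin) (simp add: field_simps)
  have e2: "complex_of_real (sin a) = (- \<i>/2) * iexp a + (\<i>/2) * iexp (- a)" for a
    by (simp only: iexp_eq_cos_sin) (simp add: field_simps)
  have e3: "iexp (a + b) = iexp a * iexp b" for a b
    by (simp add: exp_add algebra_simps)
  have plus: "iexp (blinfun_apply (t *\<^sub>R f + g) y) = iexp (t * blinfun_apply f y) * iexp (blinfun_apply g y)" for t y
    by (simp only: blinfun.bilinear_simps real_scaleR_def e3)
  have minus: "iexp (blinfun_apply (t *\<^sub>R f - g) y) = iexp (t * blinfun_apply f y) * iexp (- blinfun_apply g y)" for t y
    by (simp only: blinfun.bilinear_simps real_scaleR_def e3[symmetric] diff_conv_add_uminus)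
  have one: "complex_of_real (indicator ?S y * (1 + u)) = indicator ?S y * (1 + complex_of_real u)" for u y
    by (simp split: split_indicator)
  have 2: "(LINT y|\<mu>. (indicator ?S y * (1 + cos (g y))) * indicator A (f y)) = (LINT y|\<nu>. (indicator ?S y * (1 + cos (g y))) * indicator A (f y))"
  proof (rule comb[where b = "1/2" and d = "1/2"])
    fix y have "0 \<le> 1 + cos (g y)" "1 + cos (g y) \<le> 2" using cos_ge_minus_one[of "g y"] cos_le_one[of "g y"] by linarith+
    then show "0 \<le> indicator ?S y * (1 + cos (g y))" "indicator ?S y * (1 + cos (g y)) \<le> 2" by (auto split: split_indicator)
  next
    fix t y
    show "complex_of_real (indicator ?S y * (1 + cos (g y))) * iexp (t * f y) = 1 * (indicator ?S y * iexp (blinfun_apply (t *\<^sub>R f) y))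
           + 1/2 * (indicator ?S y * iexp (blinfun_apply (t *\<^sub>R f + g) y)) + 1/2 * (indicator ?S y * iexp (blinfun_apply (t *\<^sub>R f - g) y))"
      unfolding plus minus one e1 by (simp only: blinfun.scaleR_left real_scaleR_def algebra_simps)
  qed simp
  have 3: "(LINT y|\<mu>. (indicator ?S y * (1 + sin (g y))) * indicator A (f y)) = (LINT y|\<nu>. (indicator ?S y * (1 + sin (g y))) * indicator A (f y))"
  proof (rule comb[where b = "-\<i>/2" and d = "\<i>/2"])
    fix y have "0 \<le> 1 + sin (g y)" "1 + sin (g y) \<le> 2" using sin_ge_minus_one[of "g y"] sin_le_one[of "g y"] by linarith+
    then show "0 \<le> indicator ?S y * (1 + sin (g y))" "indicator ?S y * (1 + sin (g y)) \<le> 2" by (auto split: split_indicator)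
  next
    fix t y
    show "complex_of_real (indicator ?S y * (1 + sin (g y))) * iexp (t * f y) = 1 * (indicator ?S y * iexp (blinfun_apply (t *\<^sub>R f) y))
           + (-\<i>/2) * (indicator ?S y * iexp (blinfun_apply (t *\<^sub>R f + g) y)) + (\<i>/2) * (indicator ?S y * iexp (blinfun_apply (t *\<^sub>R f - g) y))"
      unfolding plus minus one e2 by (simp only: blinfun.scaleR_left real_scaleR_def algebra_simps)
  qed simp
  \<comment> \<open>The exponential is recovered from the nonnegative weights by
    \<open>exp (\<i> g) = ((1 + cos g) - 1) + \<i> ((1 + sin g) - 1)\<close>.\<close>
  have split: "(CLINT y|M. indicator (cylinder (a # ps)) y * iexp (g y)) =
      complex_of_real ((LINT y|M. (indicator ?S y * (1 + cos (g y))) * indicator A (f y)) - (LINT y|M. indicator ?S y * indicator A (f y)))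
      + \<i> * complex_of_real ((LINT y|M. (indicator ?S y * (1 + sin (g y))) * indicator A (f y)) - (LINT y|M. indicator ?S y * indicator A (f y)))"
    if M: "finite_measure M" and [measurable_cong]: "sets M = sets borel" for M
  proof -
    interpret finite_measure M by fact
    have bd: "integrable M h" if "h \<in> borel_measurable borel" "\<And>y. \<bar>h y\<bar> \<le> 2" for h :: "'a \<Rightarrow> real"
      using that by (intro integrable_const_bound[where B = 2]) auto
    have c: "\<bar>1 + cos u\<bar> \<le> 2" "\<bar>1 + sin u\<bar> \<le> 2" for u :: real
      using cos_ge_minus_one[of u] cos_le_one[of u] sin_ge_minus_one[of u] sin_le_one[of u] by linarith+
    have i: "integrable M (\<lambda>y. indicator ?S y * indicator A (f y) :: real)"
      "integrable M (\<lambda>y. (indicator ?S y * (1 + cos (g y))) * indicator A (f y))"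
      "integrable M (\<lambda>y. (indicator ?S y * (1 + sin (g y))) * indicator A (f y))"
      using c by (intro bd; auto split: split_indicator)+
    have "(CLINT y|M. indicator (cylinder (a # ps)) y * iexp (g y)) =
      (CLINT y|M. complex_of_real ((indicator ?S y * (1 + cos (g y))) * indicator A (f y) - indicator ?S y * indicator A (f y))
       + \<i> * complex_of_real ((indicator ?S y * (1 + sin (g y))) * indicator A (f y) - indicator ?S y * indicator A (f y)))"
      by (intro Bochner_Integration.integral_cong refl) (auto simp: a cylinder_Cons iexp_eq_cos_sin split: split_indicator)
    also have "\<dots> = complex_of_real (LINT y|M. (indicator ?S y * (1 + cos (g y))) * indicator A (f y) - indicator ?S y * indicator A (f y))
       + \<i> * complex_of_real (LINT y|M. (indicator ?S y * (1 + sin (g y))) * indicator A (f y) - indicator ?S y * indicator A (f y))"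
      using i by (subst Bochner_Integration.integral_add) (auto intro!: integrable_mult_right integrable_of_real Bochner_Integration.integrable_diff simp del: of_real_mult of_real_diff)
    finally show ?thesis using i by simp
  qed
  show ?case
    using split[of \<mu>] split[of \<nu>] assms 1 2 3 by simp
qed

text \<open>At \<open>g = 0\<close> the preceding lemma gives equality on cylinders, an
  intersection-stable generator of the Borel sets that contains the whole space.\<close>

theorem measure_eqI_char:
  fixes \<mu> \<nu> :: "'a::{real_normed_vector, second_countable_topology} measure"
  assumes fin: "finite_measure \<mu>" "finite_measure \<nu>" and sets: "sets \<mu> = sets borel" "sets \<nu> = sets borel"
    and char: "\<And>g :: 'a \<Rightarrow>\<^sub>L real. (CLINT y|\<mu>. iexp (g y)) = (CLINT y|\<nu>. iexp (g y))"
  shows "\<mu> = \<nu>"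
proof (rule measure_eqI_generator_eq[where E = cylinders and \<Omega> = UNIV and A = "\<lambda>_. UNIV"])
  show "emeasure \<mu> X = emeasure \<nu> X" if X: "X \<in> cylinders" for X
  proof -
    obtain ps where ps: "X = cylinder ps" "\<forall>(f, A) \<in> set ps. A \<in> sets borel"
      using X unfolding cylinders_def by blast
    have "X \<in> sets borel" using ps cylinder_measurable by blast
    then have m: "X \<in> sets \<mu>" "X \<in> sets \<nu>" using sets by auto
    have *: "(CLINT y|M. indicator X y) = complex_of_real (measure M X)" if "X \<in> sets M" for M
    proof -
      have "(CLINT y|M. indicator X y) = (CLINT y|M. complex_of_real (indicator X y))"
        by (intro Bochner_Integration.integral_cong) (auto split: split_indicator)
      also have "\<dots> = complex_of_real (LINT y|M. indicator X y)" by (rule integral_complex_of_real)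
      also have "\<dots> = complex_of_real (measure M X)"
        using that sets.sets_into_space[OF that] by (simp add: Int_absorb2)
      finally show ?thesis .
    qed
    have "(CLINT y|\<mu>. indicator X y) = (CLINT y|\<nu>. indicator X y)"
      using char_unique_on_cylinders[OF fin sets char ps(2), of 0] ps(1) by simp
    then have "measure \<mu> X = measure \<nu> X" using *[OF m(1)] *[OF m(2)] by simp
    then show ?thesis using fin by (simp add: finite_measure.emeasure_eq_measure)
  qed
  show "range (\<lambda>_. UNIV) \<subseteq> (cylinders :: 'a set set)"
    unfolding cylinders_def by (auto intro!: exI[of _ "[]"] simp: cylinder_def)
  show "emeasure \<mu> UNIV \<noteq> \<infinity>" using fin finite_measure.emeasure_finite[of \<mu>] by simp
qed (auto simp: Int_stable_cylinders sigma_sets_cylinders sets)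

section \<open>Square integrable functions\<close>

lemma square_integrableD:
  assumes "square_integrable M f"
  shows "f \<in> borel_measurable M" "integrable M (\<lambda>x. (f x)\<^sup>2)"
  using assms by (auto simp: square_integrable_def)

lemma square_integrable_mult:
  assumes "square_integrable M f" "square_integrable M g"
  shows "integrable M (\<lambda>x. f x * g x)"
proof (rule Bochner_Integration.integrable_bound)
  show "integrable M (\<lambda>x. (f x)\<^sup>2 + (g x)\<^sup>2)" using assms by (auto simp: square_integrable_def)
  have "\<bar>a * b\<bar> \<le> a\<^sup>2 + b\<^sup>2" for a b :: real
  proof -
    have "2 * (\<bar>a\<bar> * \<bar>b\<bar>) \<le> a\<^sup>2 + b\<^sup>2" using sum_squares_bound[of "\<bar>a\<bar>" "\<bar>b\<bar>"] by simp
    moreover have "0 \<le> \<bar>a\<bar> * \<bar>b\<bar>" by simp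
    ultimately have "\<bar>a\<bar> * \<bar>b\<bar> \<le> a\<^sup>2 + b\<^sup>2" by linarith
    then show ?thesis by (simp add: abs_mult)
  qed
  then show "AE x in M. norm (f x * g x) \<le> norm ((f x)\<^sup>2 + (g x)\<^sup>2)" by simp
qed (use assms in \<open>auto simp: square_integrable_def\<close>)

lemma square_integrable_scale: "square_integrable M f \<Longrightarrow> square_integrable M (\<lambda>x. c * f x)"
  by (auto simp: square_integrable_def power_mult_distrib)

lemma square_integrable_add:
  assumes "square_integrable M f" "square_integrable M g"
  shows "square_integrable M (\<lambda>x. f x + g x)"
  using assms square_integrable_mult[OF assms]
  by (auto simp: square_integrable_def power2_sum mult.assoc)

lemma square_integrable_diff:
  assumes "square_integrable M f" "square_integrable M g"
  shows "square_integrable M (\<lambda>x. f x - g x)"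
  using square_integrable_add[OF assms(1) square_integrable_scale[OF assms(2), of "-1"]] by simp

lemma L2_norm_nonneg: "0 \<le> L2_norm M f"
  by (simp add: L2_norm_def)

lemma L2_norm_power2: "(L2_norm M f)\<^sup>2 = (LINT x|M. (f x)\<^sup>2)"
  by (simp add: L2_norm_def)

lemma L2_norm_scale: "L2_norm M (\<lambda>x. c * f x) = \<bar>c\<bar> * L2_norm M f"
  by (simp add: L2_norm_def power_mult_distrib real_sqrt_mult)

lemma L2_norm_minus_commute: "L2_norm M (\<lambda>x. f x - g x) = L2_norm M (\<lambda>x. g x - f x)"
  by (simp add: L2_norm_def power2_commute)

lemma L2_Cauchy_Schwarz:
  assumes "square_integrable M f" "square_integrable M g"
  shows "\<bar>LINT x|M. f x * g x\<bar> \<le> L2_norm M f * L2_norm M g"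
proof -
  note [measurable] = square_integrableD(1)[OF assms(1)] square_integrableD(1)[OF assms(2)]
  have sq: "(\<integral>\<^sup>+x. ennreal \<bar>h x\<bar> ^ 2 \<partial>M) = ennreal ((L2_norm M h)\<^sup>2)" if "square_integrable M h" for h
    using square_integrableD(2)[OF that]
    by (simp add: ennreal_power L2_norm_power2 nn_integral_eq_integral)
  define I where "I = (LINT x|M. \<bar>f x * g x\<bar>)"
  have I0: "I \<ge> 0" unfolding I_def by simp
  have int: "integrable M (\<lambda>x. \<bar>f x * g x\<bar>)" using square_integrable_mult[OF assms] by simp
  have "ennreal (I\<^sup>2) = (\<integral>\<^sup>+x. ennreal \<bar>f x\<bar> * ennreal \<bar>g x\<bar> \<partial>M)\<^sup>2"
    using int by (simp add: I_def nn_integral_eq_integral ennreal_power ennreal_mult'[symmetric] abs_mult[symmetric])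
  also have "\<dots> \<le> (\<integral>\<^sup>+x. ennreal \<bar>f x\<bar> ^ 2 \<partial>M) * (\<integral>\<^sup>+x. ennreal \<bar>g x\<bar> ^ 2 \<partial>M)"
    by (rule Cauchy_Schwarz_nn_integral) auto
  also have "\<dots> = ennreal ((L2_norm M f * L2_norm M g)\<^sup>2)"
    by (simp add: sq assms ennreal_mult'[symmetric] power_mult_distrib)
  finally have "I\<^sup>2 \<le> (L2_norm M f * L2_norm M g)\<^sup>2" by (simp add: ennreal_le_iff)
  then have "I \<le> L2_norm M f * L2_norm M g"
    by (rule power2_le_imp_le) (simp add: L2_norm_nonneg)
  moreover have "\<bar>LINT x|M. f x * g x\<bar> \<le> I" unfolding I_def by (rule integral_abs_bound)
  ultimately show ?thesis by simp
qed

lemma L2_norm_add_power2: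
  assumes "square_integrable M f" "square_integrable M g"
  shows "(L2_norm M (\<lambda>x. f x + g x))\<^sup>2 = (L2_norm M f)\<^sup>2 + 2 * (LINT x|M. f x * g x) + (L2_norm M g)\<^sup>2"
  using square_integrable_mult[OF assms] square_integrableD(2)[OF assms(1)] square_integrableD(2)[OF assms(2)]
  by (simp add: L2_norm_power2 power2_sum mult.assoc)

lemma L2_norm_diff_power2:
  assumes "square_integrable M f" "square_integrable M g"
  shows "(L2_norm M (\<lambda>x. f x - g x))\<^sup>2 = (L2_norm M f)\<^sup>2 - 2 * (LINT x|M. f x * g x) + (L2_norm M g)\<^sup>2"
  using L2_norm_add_power2[OF assms(1) square_integrable_scale[OF assms(2), of "-1"]] L2_norm_scale[of M "-1" g]
  by simp

lemma L2_norm_triangle: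
  assumes "square_integrable M f" "square_integrable M g"
  shows "L2_norm M (\<lambda>x. f x + g x) \<le> L2_norm M f + L2_norm M g"
proof (rule power2_le_imp_le)
  show "(L2_norm M (\<lambda>x. f x + g x))\<^sup>2 \<le> (L2_norm M f + L2_norm M g)\<^sup>2"
    using L2_norm_add_power2[OF assms] L2_Cauchy_Schwarz[OF assms] by (simp add: power2_sum abs_le_iff)
qed (simp add: L2_norm_nonneg)

lemma L2_norm_triangle_diff:
  assumes "square_integrable M f" "square_integrable M g" "square_integrable M h"
  shows "L2_norm M (\<lambda>x. f x - h x) \<le> L2_norm M (\<lambda>x. f x - g x) + L2_norm M (\<lambda>x. g x - h x)"
  using L2_norm_triangle[OF square_integrable_diff[OF assms(1,2)] square_integrable_diff[OF assms(2,3)]] by simp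

lemma L2_norm_eq_0_AE:
  assumes "square_integrable M f" "L2_norm M f = 0"
  shows "AE x in M. f x = 0"
proof -
  have "(LINT x|M. (f x)\<^sup>2) = 0" using assms(2) by (simp add: L2_norm_def)
  then show ?thesis
    using integral_nonneg_eq_0_iff_AE[of M "\<lambda>x. (f x)\<^sup>2"] square_integrableD(2)[OF assms(1)] by simp
qed

text \<open>Riesz--Fischer: a rapidly Cauchy subsequence converges almost everywhere, and Fatou's
  lemma shows that its pointwise limit is also the limit of the full sequence in the L2
  norm.\<close>

lemma L2_complete:
  fixes f :: "nat \<Rightarrow> 'a \<Rightarrow> real"
  assumes sq: "\<And>n. square_integrable M (f n)"
    and Cauchy: "\<And>e. e > 0 \<Longrightarrow> \<exists>N. \<forall>m\<ge>N. \<forall>n\<ge>N. L2_norm M (\<lambda>x. f m x - f n x) \<le> e"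
  obtains g where "square_integrable M g" "(\<lambda>n. L2_norm M (\<lambda>x. f n x - g x)) \<longlonglongrightarrow> 0"
proof -
  have "\<forall>k. \<exists>N. \<forall>m\<ge>N. \<forall>n\<ge>N. L2_norm M (\<lambda>x. f m x - f n x) \<le> (1/4) ^ k"
    using Cauchy by simp
  then obtain t :: "nat \<Rightarrow> nat" where t: "\<And>k m n. m \<ge> t k \<Longrightarrow> n \<ge> t k \<Longrightarrow> L2_norm M (\<lambda>x. f m x - f n x) \<le> (1/4) ^ k"
    by metis
  \<comment> \<open>Summing the thresholds makes \<open>s j\<close> exceed \<open>t k\<close> for
    every \<open>k \<le> j\<close>.\<close>
  define s where "s k = sum t {..k}" for k
  have st: "t k \<le> s j" if "k \<le> j" for k j
    unfolding s_def by (rule member_le_sum) (use that in auto)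
  note [measurable] = square_integrableD(1)[OF sq]
  define d where "d k x = f (s (Suc k)) x - f (s k) x" for k x
  have d_meas[measurable]: "d k \<in> borel_measurable M" for k unfolding d_def by measurable
  have nn: "(\<integral>\<^sup>+x. ennreal ((f m x - f n x)\<^sup>2) \<partial>M) = ennreal ((L2_norm M (\<lambda>x. f m x - f n x))\<^sup>2)" for m n
    using square_integrableD(2)[OF square_integrable_diff[OF sq sq]]
    by (simp add: L2_norm_power2 nn_integral_eq_integral)
  \<comment> \<open>The squared increments have integrals at most \<open>16 ^ (- k)\<close>, which
    leaves room for the weight \<open>4 ^ k\<close>. Where the weighted sum has a finite value
    \<open>W\<close>, the increments are at most \<open>sqrt W * (1/2) ^ k\<close> and hence
    summable.\<close>
  have "(\<integral>\<^sup>+x. (\<Sum>k. ennreal (4 ^ k * (d k x)\<^sup>2)) \<partial>M) = (\<Sum>k. \<integral>\<^sup>+x. ennreal (4 ^ k * (d k x)\<^sup>2) \<partial>M)"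
    by (rule nn_integral_suminf) simp
  also have "\<dots> \<le> (\<Sum>k. ennreal ((1/4) ^ k))"
  proof (rule suminf_le)
    fix k
    have L: "L2_norm M (\<lambda>x. f (s (Suc k)) x - f (s k) x) \<le> (1/4) ^ k"
      by (rule t) (use st[of k "Suc k"] st[of k k] in auto)
    have "(\<integral>\<^sup>+x. ennreal (4 ^ k * (d k x)\<^sup>2) \<partial>M) = (\<integral>\<^sup>+x. ennreal (4 ^ k) * ennreal ((d k x)\<^sup>2) \<partial>M)"
      by (simp only: ennreal_mult''[OF zero_le_power2])
    also have "\<dots> = ennreal (4 ^ k) * (\<integral>\<^sup>+x. ennreal ((d k x)\<^sup>2) \<partial>M)"
      by (rule nn_integral_cmult) simp
    also have "\<dots> = ennreal (4 ^ k * (L2_norm M (\<lambda>x. f (s (Suc k)) x - f (s k) x))\<^sup>2)"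
      unfolding d_def nn by (simp only: ennreal_mult''[OF zero_le_power2])
    also have "\<dots> \<le> ennreal ((1/4) ^ k)"
    proof (rule ennreal_leI)
      have "4 ^ k * (L2_norm M (\<lambda>x. f (s (Suc k)) x - f (s k) x))\<^sup>2 \<le> 4 ^ k * (((1/4) ^ k)\<^sup>2 :: real)"
        by (intro mult_left_mono power_mono L) (auto simp: L2_norm_nonneg)
      also have "\<dots> = (1/4) ^ k"
        unfolding power2_eq_square power_mult_distrib[symmetric] by simp
      finally show "4 ^ k * (L2_norm M (\<lambda>x. f (s (Suc k)) x - f (s k) x))\<^sup>2 \<le> (1/4) ^ k" .
    qed
    finally show "(\<integral>\<^sup>+x. ennreal (4 ^ k * (d k x)\<^sup>2) \<partial>M) \<le> ennreal ((1/4) ^ k)" .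
  qed auto
  also have "\<dots> = ennreal (\<Sum>k. (1/4) ^ k)"
    by (rule suminf_ennreal2) (auto intro: summable_geometric)
  also have "\<dots> < \<infinity>" by simp
  finally have "AE x in M. (\<Sum>k. ennreal (4 ^ k * (d k x)\<^sup>2)) \<noteq> \<infinity>"
    by (intro nn_integral_PInf_AE) auto
  then have conv: "AE x in M. convergent (\<lambda>k. f (s k) x)"
  proof eventually_elim
    case (elim x)
    have "\<exists>W\<ge>0. z = ennreal W" if "z \<noteq> \<infinity>" for z :: ennreal
      using that by (cases z) auto
    from this[OF elim] obtain W where W: "(\<Sum>k. ennreal (4 ^ k * (d k x)\<^sup>2)) = ennreal W" "W \<ge> 0"
      by blast
    have le: "4 ^ k * (d k x)\<^sup>2 \<le> W" for k
    proof -
      have "(\<Sum>i\<in>{k}. ennreal (4 ^ i * (d i x)\<^sup>2)) \<le> (\<Sum>k. ennreal (4 ^ k * (d k x)\<^sup>2))"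
        by (rule sum_le_suminf) auto
      then show ?thesis using W by simp
    qed
    then have bd: "(2 ^ k * \<bar>d k x\<bar>)\<^sup>2 \<le> W" for k
    proof -
      have "(2 ^ k)\<^sup>2 = (4 :: real) ^ k" by (simp add: power2_eq_square flip: power_mult_distrib)
      then show ?thesis using le[of k] by (simp add: power_mult_distrib)
    qed
    have dk: "norm (d k x) \<le> sqrt W * (1/2) ^ k" for k
    proof -
      have "2 ^ k * \<bar>d k x\<bar> \<le> sqrt W" by (rule real_le_rsqrt[OF bd])
      then have "\<bar>d k x\<bar> \<le> sqrt W / 2 ^ k" by (simp add: pos_le_divide_eq mult.commute)
      moreover have "sqrt W * (1/2) ^ k = sqrt W / 2 ^ k" unfolding power_one_over by simp
      ultimately show ?thesis by (simp only: real_norm_def)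
    qed
    have "summable (\<lambda>k. sqrt W * (1/2) ^ k)" by (intro summable_mult summable_geometric) simp
    then have "summable (\<lambda>k. d k x)"
      by (rule summable_comparison_test'[where N = 0]) (rule dk)
    then have "convergent (\<lambda>n. f (s 0) x + (\<Sum>k<n. d k x))"
      by (intro convergent_add convergent_const) (simp add: summable_iff_convergent)
    moreover have "f (s 0) x + (\<Sum>k<n. d k x) = f (s n) x" for n
      by (induction n) (auto simp: d_def)
    ultimately show ?case by simp
  qed
  define g where "g x = lim (\<lambda>k. f (s k) x)" for x
  have [measurable]: "g \<in> borel_measurable M" unfolding g_def by measurable
  \<comment> \<open>Here \<open>n\<close> runs over all indices beyond \<open>t k\<close>, not only
    those of the subsequence; this gives convergence of the whole sequence.\<close>
  have Fatou: "(\<integral>\<^sup>+x. ennreal ((f n x - g x)\<^sup>2) \<partial>M) \<le> ennreal (((1/4) ^ k)\<^sup>2)" if n: "n \<ge> t k" for n k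
  proof -
    have "(\<integral>\<^sup>+x. ennreal ((f n x - g x)\<^sup>2) \<partial>M) = (\<integral>\<^sup>+x. liminf (\<lambda>j. ennreal ((f n x - f (s j) x)\<^sup>2)) \<partial>M)"
    proof (rule nn_integral_cong_AE)
      show "AE x in M. ennreal ((f n x - g x)\<^sup>2) = liminf (\<lambda>j. ennreal ((f n x - f (s j) x)\<^sup>2))"
        using conv
      proof eventually_elim
        case (elim x)
        then have "(\<lambda>j. f (s j) x) \<longlonglongrightarrow> g x" unfolding g_def by (simp add: convergent_LIMSEQ_iff)
        then have "(\<lambda>j. ennreal ((f n x - f (s j) x)\<^sup>2)) \<longlonglongrightarrow> ennreal ((f n x - g x)\<^sup>2)"
          by (intro tendsto_intros)
        then show ?case by (rule lim_imp_Liminf[OF sequentially_bot, symmetric])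
      qed
    qed
    also have "\<dots> \<le> liminf (\<lambda>j. \<integral>\<^sup>+x. ennreal ((f n x - f (s j) x)\<^sup>2) \<partial>M)"
      by (rule nn_integral_liminf) simp
    also have "\<dots> \<le> limsup (\<lambda>j. \<integral>\<^sup>+x. ennreal ((f n x - f (s j) x)\<^sup>2) \<partial>M)"
      by (rule Liminf_le_Limsup) simp
    also have "\<dots> \<le> ennreal (((1/4) ^ k)\<^sup>2)"
    proof (rule Limsup_bounded)
      show "\<forall>\<^sub>F j in sequentially. (\<integral>\<^sup>+x. ennreal ((f n x - f (s j) x)\<^sup>2) \<partial>M) \<le> ennreal (((1/4) ^ k)\<^sup>2)"
        using eventually_ge_at_top[of k]
      proof eventually_elim
        case (elim j)
        then show ?case unfolding nn
          by (intro ennreal_leI power_mono t n st) (auto simp: L2_norm_nonneg)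
      qed
    qed
    finally show ?thesis .
  qed
  have sqd: "square_integrable M (\<lambda>x. f n x - g x)" if "n \<ge> t k" for n k
    unfolding square_integrable_def
  proof
    show "integrable M (\<lambda>x. (f n x - g x)\<^sup>2)"
      by (rule integrableI_nonneg) (use Fatou[OF that] in \<open>auto intro: le_less_trans\<close>)
  qed simp
  have g: "square_integrable M g"
    using square_integrable_diff[OF sq[of "t 0"] sqd[OF order_refl, of 0]] by simp
  have le: "L2_norm M (\<lambda>x. f n x - g x) \<le> (1/4) ^ k" if "n \<ge> t k" for n k
  proof -
    have "ennreal ((L2_norm M (\<lambda>x. f n x - g x))\<^sup>2) \<le> ennreal (((1/4) ^ k)\<^sup>2)"
      using Fatou[OF that] square_integrableD(2)[OF sqd[OF that]]
      by (simp add: L2_norm_power2 nn_integral_eq_integral)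
    then have "(L2_norm M (\<lambda>x. f n x - g x))\<^sup>2 \<le> ((1/4) ^ k)\<^sup>2" by (subst (asm) ennreal_le_iff) auto
    then show ?thesis by (rule power2_le_imp_le) simp
  qed
  have "(\<lambda>n. L2_norm M (\<lambda>x. f n x - g x)) \<longlonglongrightarrow> 0"
  proof (rule LIMSEQ_I)
    fix e :: real assume "0 < e"
    then obtain k where k: "(1/4) ^ k < e" using real_arch_pow_inv[of e "1/4"] by auto
    show "\<exists>no. \<forall>n\<ge>no. norm (L2_norm M (\<lambda>x. f n x - g x) - 0) < e"
      using le[of k] k by (intro exI[of _ "t k"]) (auto simp: L2_norm_nonneg intro: le_less_trans)
  qed
  with g show thesis by (rule that)
qed

section \<open>Centred Gaussian measures and the operator \<open>R_op\<close>\<close>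

lemma distr_const_return:
  assumes "prob_space M" "c \<in> space N"
  shows "distr M N (\<lambda>_. c) = return N c"
proof (rule measure_eqI)
  fix A assume "A \<in> sets (distr M N (\<lambda>_. c))"
  then have A: "A \<in> sets N" by simp
  have "(\<lambda>_. c) -` A \<inter> space M = (if c \<in> A then space M else {})" by auto
  then show "emeasure (distr M N (\<lambda>_. c)) A = emeasure (return N c) A"
    using assms A prob_space.emeasure_space_1[OF assms(1)]
    by (subst emeasure_distr) auto
qed simp

lemma std_normal_scaled:
  assumes "s > 0"
  shows "distr std_normal_distribution borel (\<lambda>t. s * t) = density lborel (\<lambda>t. ennreal (normal_density 0 s t))"
proof -
  interpret real_distribution std_normal_distribution by (rule real_dist_normal_dist)
  have "distributed std_normal_distribution lborel (\<lambda>x. x) std_normal_density"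
    unfolding distributed_def
    by (auto simp: distr_id2)
  then have "distributed std_normal_distribution lborel (\<lambda>x. 0 + s * x) (normal_density (0 + s * 0) (\<bar>s\<bar> * 1))"
    by (rule normal_density_affine) (use assms in auto)
  then have "distr std_normal_distribution lborel (\<lambda>x. s * x) = density lborel (\<lambda>t. ennreal (normal_density 0 s t))"
    using assms by (simp add: distributed_def)
  moreover have "distr std_normal_distribution lborel (\<lambda>x. s * x) = distr std_normal_distribution borel (\<lambda>x. s * x)"
    by (rule distr_cong) auto
  ultimately show ?thesis by simp
qed

lemma std_normal_moments:
  shows "integrable std_normal_distribution (\<lambda>t. t\<^sup>2)" "(LINT t|std_normal_distribution. t\<^sup>2) = 1"
  using integrable_std_normal_distribution_moment[of 2] std_normal_distribution_even_moments[of 1]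
  by (auto simp: fact_numeral numeral_2_eq_2)

lemma std_normal_iexp: "(CLINT t|std_normal_distribution. iexp (s * t)) = complex_of_real (exp (- (s\<^sup>2) / 2))"
  using fun_cong[OF char_std_normal_distribution, of s] by (simp add: char_def)

text \<open>The density is at most \<open>1 / 2\<close> because
  \<open>sqrt (2 * pi) \<ge> 2\<close>, and the interval has length \<open>2 * m\<close>.\<close>

lemma std_normal_small_ball:
  assumes "m \<ge> 0"
  shows "measure std_normal_distribution {- m .. m} \<le> m"
proof -
  interpret real_distribution std_normal_distribution by (rule real_dist_normal_dist)
  have le: "std_normal_density t \<le> 1 / 2" for t
  proof -
    have "2 \<le> sqrt (2 * pi)" by (rule real_le_rsqrt) (use pi_gt3 in simp)
    then have "1 / sqrt (2 * pi) \<le> 1 / 2" by (intro divide_left_mono) auto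
    moreover have "exp (- t\<^sup>2 / 2) \<le> 1" by simp
    ultimately have "1 / sqrt (2 * pi) * exp (- t\<^sup>2 / 2) \<le> 1 / 2 * 1" by (intro mult_mono) auto
    then show ?thesis by (simp add: std_normal_density_def)
  qed
  have "emeasure std_normal_distribution {- m .. m} = (\<integral>\<^sup>+t. ennreal (std_normal_density t) * indicator {- m .. m} t \<partial>lborel)"
    by (rule emeasure_density) auto
  also have "\<dots> \<le> (\<integral>\<^sup>+t. ennreal (1 / 2) * indicator {- m .. m} t \<partial>lborel)"
    by (intro nn_integral_mono mult_right_mono ennreal_leI le) auto
  also have "\<dots> = ennreal (1 / 2) * ennreal (2 * m)"
    using assms by (subst nn_integral_cmult_indicator) auto
  also have "\<dots> = ennreal m" using assms by (subst ennreal_mult[symmetric]) auto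
  finally show ?thesis using assms by (simp add: emeasure_eq_measure)
qed

text \<open>Nondegeneracy stays outside the locale because the measures obtained by splitting off a
  functional are degenerate: that functional vanishes almost surely under them.\<close>

locale centred_gaussian = prob_space \<gamma>
  for \<gamma> :: "'a::{banach, second_countable_topology} measure" +
  assumes gaussian: "gaussian_measure \<gamma>" and centred: "centred_measure \<gamma>"
begin

lemma sets_eq_borel [simp, measurable_cong]: "sets \<gamma> = sets borel"
  using gaussian by (simp add: gaussian_measure_def)

lemma space_eq_UNIV [simp]: "space \<gamma> = UNIV"
  using sets_eq_imp_space_eq[OF sets_eq_borel] by simp

text \<open>Writing the law as a scaled standard normal treats variance zero, a Dirac measure at the
  origin, together with the positive variances.\<close>

lemma functional_law:
  fixes f :: "'a \<Rightarrow>\<^sub>L real"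
  shows "distr \<gamma> borel f = distr std_normal_distribution borel (\<lambda>t. L2_norm \<gamma> f * t)"
proof -
  let ?N = "std_normal_distribution"
  have mean: "(LINT t|distr \<gamma> borel f. t) = 0"
    using centred by (subst integral_distr) (auto simp: centred_measure_def)
  have var: "(LINT t|distr \<gamma> borel f. t\<^sup>2) = (L2_norm \<gamma> f)\<^sup>2"
    by (subst integral_distr) (auto simp: L2_norm_power2)
  have N: "prob_space ?N" using real_dist_normal_dist by (simp add: real_distribution_def)
  have "real_gaussian (distr \<gamma> borel f)" using gaussian by (simp add: gaussian_measure_def)
  then consider m where "distr \<gamma> borel f = return borel m"
    | m s where "s > 0" "distr \<gamma> borel f = density lborel (\<lambda>t. ennreal (normal_density m s t))"
    unfolding real_gaussian_def by blast
  then show ?thesis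
  proof cases
    case 1
    have "m = 0" using mean unfolding 1 by (simp add: integral_return)
    moreover have "L2_norm \<gamma> f = 0" using var \<open>m = 0\<close> unfolding 1 by (simp add: integral_return)
    ultimately show ?thesis using 1 distr_const_return[OF N, of "0 :: real" borel] by simp
  next
    case 2
    have "m = 0" using mean unfolding 2 by (subst (asm) integral_density) (use 2 integral_normal_moment_nz_1[of s m] in auto)
    have "(L2_norm \<gamma> f)\<^sup>2 = (LINT t|density lborel (\<lambda>t. ennreal (normal_density m s t)). t\<^sup>2)"
      using var unfolding 2 by simp
    also have "\<dots> = (LINT t|distr ?N borel (\<lambda>t. s * t). t\<^sup>2)"
      using std_normal_scaled[OF \<open>s > 0\<close>] \<open>m = 0\<close> by simp
    also have "\<dots> = (LINT t|?N. s\<^sup>2 * t\<^sup>2)"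
      by (subst integral_distr) (auto simp: power_mult_distrib)
    also have "\<dots> = s\<^sup>2" using std_normal_moments by simp
    finally have "L2_norm \<gamma> f = s"
      using \<open>s > 0\<close> L2_norm_nonneg[of \<gamma> f] by (metis less_imp_le power2_eq_imp_eq)
    then show ?thesis using 2 \<open>m = 0\<close> std_normal_scaled[OF \<open>s > 0\<close>] by simp
  qed
qed

lemma functional_square_integrable: "square_integrable \<gamma> (blinfun_apply f)"
proof -
  have "integrable (distr std_normal_distribution borel (\<lambda>t. L2_norm \<gamma> f * t)) (\<lambda>t. t\<^sup>2)"
    by (subst integrable_distr_eq) (auto simp: power_mult_distrib std_normal_moments)
  then have "integrable \<gamma> (\<lambda>x. (f x)\<^sup>2)"
    unfolding functional_law[symmetric] by (subst (asm) integrable_distr_eq) auto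
  then show ?thesis by (simp add: square_integrable_def)
qed

lemma char_functional: "(CLINT y|\<gamma>. iexp (blinfun_apply f y)) = complex_of_real (exp (- ((L2_norm \<gamma> f)\<^sup>2) / 2))"
proof -
  have "(CLINT y|\<gamma>. iexp (blinfun_apply f y)) = (CLINT t|distr \<gamma> borel f. iexp t)"
    by (subst integral_distr) auto
  also have "\<dots> = (CLINT t|std_normal_distribution. iexp (L2_norm \<gamma> f * t))"
    unfolding functional_law by (subst integral_distr) auto
  finally show ?thesis by (simp only: std_normal_iexp)
qed

text \<open>The bound for the standard normal on the interval of half-width
  \<open>m / \<sigma>\<close>, multiplied out so that \<open>\<sigma> = 0\<close> is
  included.\<close>

lemma small_ball: "m \<ge> 0 \<Longrightarrow> L2_norm \<gamma> (blinfun_apply f) * measure \<gamma> {y. \<bar>f y\<bar> \<le> m} \<le> m"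
proof (cases "L2_norm \<gamma> f = 0")
  case False
  assume m: "m \<ge> 0"
  define s where "s = L2_norm \<gamma> f"
  have s: "s > 0" using False L2_norm_nonneg[of \<gamma> f] by (simp add: s_def)
  have "{y. \<bar>f y\<bar> \<le> m} = blinfun_apply f -` {- m .. m} \<inter> space \<gamma>" by auto
  then have "measure \<gamma> {y. \<bar>f y\<bar> \<le> m} = measure (distr \<gamma> borel f) {- m .. m}"
    by (simp add: measure_distr)
  also have "\<dots> = measure std_normal_distribution ((\<lambda>t. s * t) -` {- m .. m} \<inter> UNIV)"
    unfolding functional_law s_def[symmetric] by (subst measure_distr) auto
  also have "(\<lambda>t. s * t) -` {- m .. m} \<inter> UNIV = {- (m / s) .. m / s}"
    using s by (auto simp: field_simps)
  also have "measure std_normal_distribution \<dots> \<le> m / s"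
    using m s by (intro std_normal_small_ball) simp
  finally show ?thesis using s by (simp add: s_def field_simps)
qed simp

text \<open>A normal variable that stays in a short interval with probability above
  \<open>1 / 2\<close> has small standard deviation. Some ball of radius \<open>n\<close> carries
  more than half of the mass, and on it \<open>\<bar>f\<bar>\<close> is at most
  \<open>norm f * n\<close>, so \<open>small_ball\<close> gives the constant
  \<open>2 * n\<close>.\<close>

lemma L2_norm_functional_bounded:
  obtains C where "C \<ge> 0" "\<And>f :: 'a \<Rightarrow>\<^sub>L real. L2_norm \<gamma> (blinfun_apply f) \<le> C * norm f"
proof -
  have "(\<lambda>n. measure \<gamma> (cball 0 (real n))) \<longlonglongrightarrow> measure \<gamma> (\<Union>n. cball 0 (real n))"
    by (intro finite_Lim_measure_incseq) (auto simp: incseq_def)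
  also have "(\<Union>n. cball (0 :: 'a) (real n)) = space \<gamma>"
    using real_arch_simple by (auto simp: real_arch_simple)
  finally have "(\<lambda>n. measure \<gamma> (cball 0 (real n))) \<longlonglongrightarrow> 1" unfolding prob_space .
  then have "\<forall>\<^sub>F n in sequentially. 1 / 2 < measure \<gamma> (cball 0 (real n))"
    by (rule order_tendstoD) simp
  then obtain n where n: "1 / 2 < measure \<gamma> (cball 0 (real n))"
    using eventually_happens by fastforce
  have "L2_norm \<gamma> f \<le> (2 * real n) * norm f" for f :: "'a \<Rightarrow>\<^sub>L real"
  proof -
    let ?m = "norm f * real n"
    have "L2_norm \<gamma> f * (1 / 2) \<le> L2_norm \<gamma> f * measure \<gamma> {y. \<bar>f y\<bar> \<le> ?m}"
    proof (rule mult_left_mono)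
      have "cball 0 (real n) \<subseteq> {y. \<bar>f y\<bar> \<le> ?m}"
      proof
        fix y :: 'a assume "y \<in> cball 0 (real n)"
        then have "norm f * norm y \<le> ?m" by (intro mult_left_mono) auto
        then show "y \<in> {y. \<bar>f y\<bar> \<le> ?m}" using norm_blinfun[of f y] by simp
      qed
      then have "measure \<gamma> (cball 0 (real n)) \<le> measure \<gamma> {y. \<bar>f y\<bar> \<le> ?m}"
        by (intro finite_measure_mono) auto
      then show "1 / 2 \<le> measure \<gamma> {y. \<bar>f y\<bar> \<le> ?m}" using n by simp
    qed (rule L2_norm_nonneg)
    also have "\<dots> \<le> ?m" by (rule small_ball) simp
    finally show ?thesis by (simp add: mult.commute mult.left_commute)
  qed
  then show thesis using that[of "2 * real n"] by simp
qed

text \<open>The representing element is the limit of the Bochner integrals of \<open>u(y) y\<close> over balls, so no moment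
  bound on the norm (Fernique's theorem) is required.\<close>

lemma represents_exists:
  assumes u: "square_integrable \<gamma> u"
  shows "\<exists>h. \<forall>g :: 'a \<Rightarrow>\<^sub>L real. g h = (LINT y|\<gamma>. u y * g y)"
proof -
  note [measurable] = square_integrableD(1)[OF u]
  obtain C where C: "C \<ge> 0" "\<And>f :: 'a \<Rightarrow>\<^sub>L real. L2_norm \<gamma> (blinfun_apply f) \<le> C * norm f"
    using L2_norm_functional_bounded by blast
  have u1: "integrable \<gamma> u" using square_integrable_imp_integrable[of u] u by (simp add: square_integrable_def)
  define B :: "nat \<Rightarrow> 'a set" where "B n = cball 0 (real n)" for n
  have [measurable]: "B n \<in> sets borel" for n unfolding B_def by simp
  define h where "h n = (LINT y|\<gamma>. (indicator (B n) y * u y) *\<^sub>R y)" for n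
  have int: "integrable \<gamma> (\<lambda>y. (indicator (B n) y * u y) *\<^sub>R y)" for n
  proof (rule Bochner_Integration.integrable_bound)
    show "integrable \<gamma> (\<lambda>y. real n * u y)" using u1 by simp
    show "AE y in \<gamma>. norm ((indicator (B n) y * u y) *\<^sub>R y) \<le> norm (real n * u y)"
      by (intro AE_I2) (auto simp: B_def abs_mult mult.commute intro!: mult_right_mono split: split_indicator)
  qed measurable
  have gh: "g (h n) = (LINT y|\<gamma>. (indicator (B n) y * u y) * g y)" for g :: "'a \<Rightarrow>\<^sub>L real" and n
    unfolding h_def integral_bounded_linear[OF blinfun.bounded_linear_right int, symmetric]
    by (simp add: blinfun.scaleR_right)
  have sqi: "square_integrable \<gamma> (\<lambda>y. indicator A y * u y)" if [measurable]: "A \<in> sets borel" for A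
    unfolding square_integrable_def
  proof
    show "integrable \<gamma> (\<lambda>y. (indicator A y * u y)\<^sup>2)"
      using square_integrableD(2)[OF u]
      by (rule Bochner_Integration.integrable_bound) (auto split: split_indicator)
  qed measurable
  \<comment> \<open>The L2 norm of \<open>u\<close> outside the ball of radius \<open>n\<close>; it
    tends to zero by dominated convergence and controls the increments of \<open>h\<close>.\<close>
  define \<tau> where "\<tau> n = L2_norm \<gamma> (\<lambda>y. indicator (- B n) y * u y)" for n
  have "(\<lambda>n. LINT y|\<gamma>. (indicator (- B n) y * u y)\<^sup>2) \<longlonglongrightarrow> (LINT y|\<gamma>. 0)"
  proof (rule integral_dominated_convergence[where w = "\<lambda>y. (u y)\<^sup>2"])
    show "AE y in \<gamma>. (\<lambda>n. (indicator (- B n) y * u y)\<^sup>2) \<longlonglongrightarrow> 0"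
    proof (rule AE_I2)
      fix y :: 'a
      obtain N :: nat where N: "norm y \<le> real N" using real_arch_simple by blast
      show "(\<lambda>n. (indicator (- B n) y * u y)\<^sup>2) \<longlonglongrightarrow> 0"
        by (rule tendsto_eventually) (use N in \<open>auto simp: B_def eventually_sequentially intro!: exI[of _ N]\<close>)
    qed
  qed (use square_integrableD(2)[OF u] in \<open>auto split: split_indicator\<close>)
  then have \<tau>0: "\<tau> \<longlonglongrightarrow> 0"
    using tendsto_real_sqrt[of "\<lambda>n. LINT y|\<gamma>. (indicator (- B n) y * u y)\<^sup>2" 0 sequentially] unfolding \<tau>_def L2_norm_def by simp
  have diff: "norm (h m - h n) \<le> \<tau> n * C" if "n \<le> m" for m n
  proof -
    \<comment> \<open>A norming functional turns the norm of the increment into a real integral over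
      the shell \<open>B m - B n\<close>. Cauchy--Schwarz bounds it by the tail of \<open>u\<close>
      times the standard deviation of \<open>g\<close>.\<close>
    obtain g :: "'a \<Rightarrow>\<^sub>L real" where g: "norm g \<le> 1" "g (h m - h n) = norm (h m - h n)"
      using norming_functional by blast
    have ip: "integrable \<gamma> (\<lambda>y. (indicator (B n) y * u y) * g y)" for n
      by (intro square_integrable_mult sqi functional_square_integrable) simp
    have "norm (h m - h n) = (LINT y|\<gamma>. (indicator (B m) y * u y) * g y) - (LINT y|\<gamma>. (indicator (B n) y * u y) * g y)"
      using g(2) by (simp add: blinfun.diff_right gh)
    also have "\<dots> = (LINT y|\<gamma>. (indicator (B m) y * u y) * g y - (indicator (B n) y * u y) * g y)"
      using ip by simp
    also have "\<dots> = (LINT y|\<gamma>. (indicator (B m - B n) y * u y) * g y)"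
      using that by (intro Bochner_Integration.integral_cong) (auto simp: B_def split: split_indicator)
    also have "\<dots> \<le> L2_norm \<gamma> (\<lambda>y. indicator (B m - B n) y * u y) * L2_norm \<gamma> g"
      using L2_Cauchy_Schwarz[OF sqi functional_square_integrable, of "B m - B n" g] by simp
    also have "\<dots> \<le> \<tau> n * C"
    proof (rule mult_mono)
      show "L2_norm \<gamma> (\<lambda>y. indicator (B m - B n) y * u y) \<le> \<tau> n"
        unfolding \<tau>_def L2_norm_def
        by (intro real_sqrt_le_mono integral_mono square_integrableD(2) sqi) (auto split: split_indicator)
      show "L2_norm \<gamma> g \<le> C" using C(2)[of g] mult_left_mono[OF g(1) C(1)] by simp
    qed (auto simp: \<tau>_def L2_norm_nonneg)
    finally show ?thesis .
  qed
  have "Cauchy h"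
  proof (rule CauchyI')
    fix e :: real assume e: "0 < e"
    have "(\<lambda>n. \<tau> n * C) \<longlonglongrightarrow> 0" using tendsto_mult_left_zero[OF \<tau>0] by simp
    then have "\<forall>\<^sub>F n in sequentially. \<tau> n * C < e" using e by (rule order_tendstoD)
    then obtain N where N: "\<And>n. n \<ge> N \<Longrightarrow> \<tau> n * C < e" unfolding eventually_sequentially by blast
    show "\<exists>M. \<forall>m\<ge>M. \<forall>n>m. dist (h m) (h n) < e"
    proof (intro exI[of _ N] allI impI)
      fix m n assume mn: "N \<le> m" "m < n"
      have "dist (h m) (h n) = norm (h n - h m)" by (simp add: dist_norm norm_minus_commute)
      also have "\<dots> \<le> \<tau> m * C" using mn by (intro diff) simp
      also have "\<dots> < e" using mn by (intro N)
      finally show "dist (h m) (h n) < e" .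
    qed
  qed
  then have "convergent h" by (rule Cauchy_convergent)
  then obtain H where H: "h \<longlonglongrightarrow> H" unfolding convergent_def by (rule exE)
  have "g H = (LINT y|\<gamma>. u y * g y)" for g :: "'a \<Rightarrow>\<^sub>L real"
  proof (rule LIMSEQ_unique)
    show "(\<lambda>n. g (h n)) \<longlonglongrightarrow> g H" by (intro tendsto_intros H)
    show "(\<lambda>n. g (h n)) \<longlonglongrightarrow> (LINT y|\<gamma>. u y * g y)"
      unfolding gh
    proof (rule integral_dominated_convergence[where w = "\<lambda>y. \<bar>u y * g y\<bar>"])
      show "integrable \<gamma> (\<lambda>y. \<bar>u y * g y\<bar>)"
        using square_integrable_mult[OF u functional_square_integrable] by simp
      show "AE y in \<gamma>. (\<lambda>n. (indicator (B n) y * u y) * g y) \<longlonglongrightarrow> u y * g y"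
      proof (rule AE_I2)
        fix y :: 'a
        obtain N :: nat where N: "norm y \<le> real N" using real_arch_simple by blast
        show "(\<lambda>n. (indicator (B n) y * u y) * g y) \<longlonglongrightarrow> u y * g y"
          by (rule tendsto_eventually) (use N in \<open>auto simp: B_def eventually_sequentially intro!: exI[of _ N]\<close>)
      qed
    qed (auto split: split_indicator)
  qed
  then show ?thesis by blast
qed

section \<open>Linearity and continuity of \<open>R_op\<close> on square integrable
  functions\<close>

lemma R_op_apply:
  fixes g :: "'a \<Rightarrow>\<^sub>L real"
  assumes "square_integrable \<gamma> u"
  shows "g (R_op \<gamma> u) = (LINT y|\<gamma>. u y * g y)"
proof -
  obtain h where h: "\<forall>g :: 'a \<Rightarrow>\<^sub>L real. blinfun_apply g h = (LINT y|\<gamma>. u y * blinfun_apply g y)"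
    using represents_exists[OF assms] by (rule exE)
  have "R_op \<gamma> u = h"
    unfolding R_op_def
  proof (rule the_equality)
    fix k assume "\<forall>g :: 'a \<Rightarrow>\<^sub>L real. blinfun_apply g k = (LINT y|\<gamma>. u y * blinfun_apply g y)"
    then have "blinfun_apply g k = blinfun_apply g h" for g :: "'a \<Rightarrow>\<^sub>L real" using h by (simp only:)
    then show "k = h" by (rule functionals_separate_points)
  qed (rule h)
  then show ?thesis by (simp only: h)
qed

lemma R_op_eqI:
  assumes "square_integrable \<gamma> u" "\<And>g :: 'a \<Rightarrow>\<^sub>L real. g h = (LINT y|\<gamma>. u y * g y)"
  shows "R_op \<gamma> u = h"
  by (rule functionals_separate_points) (simp add: R_op_apply assms)

lemma R_op_add:
  assumes "square_integrable \<gamma> u" "square_integrable \<gamma> v"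
  shows "R_op \<gamma> (\<lambda>y. u y + v y) = R_op \<gamma> u + R_op \<gamma> v"
proof (rule R_op_eqI[OF square_integrable_add[OF assms]])
  fix g :: "'a \<Rightarrow>\<^sub>L real"
  show "g (R_op \<gamma> u + R_op \<gamma> v) = (LINT y|\<gamma>. (u y + v y) * g y)"
    using square_integrable_mult[OF assms(1) functional_square_integrable, of g]
      square_integrable_mult[OF assms(2) functional_square_integrable, of g]
    by (simp add: blinfun.add_right R_op_apply assms distrib_right)
qed

lemma R_op_scale:
  assumes "square_integrable \<gamma> u"
  shows "R_op \<gamma> (\<lambda>y. c * u y) = c *\<^sub>R R_op \<gamma> u"
  by (rule R_op_eqI[OF square_integrable_scale[OF assms]])
    (simp add: blinfun.scaleR_right R_op_apply assms mult.assoc)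

lemma R_op_diff:
  assumes "square_integrable \<gamma> u" "square_integrable \<gamma> v"
  shows "R_op \<gamma> (\<lambda>y. u y - v y) = R_op \<gamma> u - R_op \<gamma> v"
  using R_op_add[OF assms(1) square_integrable_scale[OF assms(2), of "-1"]] R_op_scale[OF assms(2), of "-1"]
  by simp

text \<open>Continuity from the L2 norm to the norm of \<open>X\<close>, by Cauchy--Schwarz against
  a norming functional; it carries the ball constraint to the limit of a minimising
  sequence.\<close>

lemma R_op_bounded:
  obtains C where "C \<ge> 0" "\<And>u. square_integrable \<gamma> u \<Longrightarrow> norm (R_op \<gamma> u) \<le> C * L2_norm \<gamma> u"
proof -
  obtain C where C: "C \<ge> 0" "\<And>f :: 'a \<Rightarrow>\<^sub>L real. L2_norm \<gamma> (blinfun_apply f) \<le> C * norm f"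
    using L2_norm_functional_bounded by blast
  have "norm (R_op \<gamma> u) \<le> C * L2_norm \<gamma> u" if u: "square_integrable \<gamma> u" for u
  proof -
    obtain g :: "'a \<Rightarrow>\<^sub>L real" where g: "norm g \<le> 1" "g (R_op \<gamma> u) = norm (R_op \<gamma> u)"
      using norming_functional by blast
    have "norm (R_op \<gamma> u) \<le> L2_norm \<gamma> u * L2_norm \<gamma> g"
      using L2_Cauchy_Schwarz[OF u functional_square_integrable, of g] g R_op_apply[OF u, of g] by simp
    also have "\<dots> \<le> L2_norm \<gamma> u * C"
      using C(2)[of g] mult_left_mono[OF g(1) C(1)] by (intro mult_left_mono) (auto simp: L2_norm_nonneg)
    finally show ?thesis by (simp add: mult.commute)
  qed
  then show thesis using that C by blast
qed

end

section \<open>The Prekopa--Leindler inequality on the line\<close>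

text \<open>One-dimensional Brunn--Minkowski. For \<open>a\<close> near the supremum of
  \<open>A\<close> and \<open>b\<close> near the infimum of \<open>B\<close>, the sets
  \<open>(A + b) / 2\<close> and \<open>(a + B) / 2\<close> lie in \<open>C\<close> and overlap only
  inside the short interval \<open>J\<close>. \<open>C\<close> is any Borel set containing the
  midpoints, as the set of midpoints itself need not be Borel.\<close>

lemma lborel_midpoint_bounded:
  fixes A B C :: "real set"
  assumes [measurable]: "A \<in> sets borel" "B \<in> sets borel" "C \<in> sets borel"
    and ne: "A \<noteq> {}" "B \<noteq> {}" and bdd: "bdd_above A" "bdd_below B"
    and mid: "\<And>a b. a \<in> A \<Longrightarrow> b \<in> B \<Longrightarrow> (a + b) / 2 \<in> C"
  shows "emeasure lborel A + emeasure lborel B \<le> 2 * emeasure lborel C"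
proof (rule ennreal_le_epsilon)
  fix e :: real assume e: "0 < e"
  obtain a where a: "a \<in> A" "Sup A - e / 2 < a"
    using less_cSup_iff[OF ne(1) bdd(1), of "Sup A - e / 2"] e by auto
  obtain b where b: "b \<in> B" "b < Inf B + e / 2"
    using cInf_less_iff[OF ne(2) bdd(2), of "Inf B + e / 2"] e by auto
  define J where "J = {(Inf B + a) / 2 .. (Sup A + b) / 2}"
  have [measurable]: "J \<in> sets borel" by (simp add: J_def)
  have affine: "emeasure lborel S = 2 * (\<integral>\<^sup>+u. indicator S (- c + 2 * u) \<partial>lborel)"
    if [measurable]: "S \<in> sets borel" for S :: "real set" and c
    using nn_integral_real_affine[of "indicator S" 2 "- c"] by simp
  have "emeasure lborel A + emeasure lborel B
      = 2 * ((\<integral>\<^sup>+u. indicator A (- b + 2 * u) \<partial>lborel) + (\<integral>\<^sup>+u. indicator B (- a + 2 * u) \<partial>lborel))"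
    by (simp add: affine[of A b] affine[of B a] distrib_left)
  also have "(\<integral>\<^sup>+u. indicator A (- b + 2 * u) \<partial>lborel) + (\<integral>\<^sup>+u. indicator B (- a + 2 * u) \<partial>lborel)
      = (\<integral>\<^sup>+u. indicator A (- b + 2 * u) + indicator B (- a + 2 * u) \<partial>lborel)"
    by (rule nn_integral_add[symmetric]) auto
  also have "\<dots> \<le> (\<integral>\<^sup>+u. indicator C u + indicator J u \<partial>lborel)"
  proof (rule nn_integral_mono)
    fix u :: real
    have "u \<in> C" if "- b + 2 * u \<in> A" using mid[OF that b(1)] by simp
    moreover have "u \<in> C" if "- a + 2 * u \<in> B" using mid[OF a(1) that] by simp
    moreover have "u \<in> J" if "- b + 2 * u \<in> A" "- a + 2 * u \<in> B"
      using cSup_upper[OF that(1) bdd(1)] cInf_lower[OF that(2) bdd(2)] by (simp add: J_def field_simps)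
    ultimately show "indicator A (- b + 2 * u) + indicator B (- a + 2 * u) \<le> (indicator C u + indicator J u :: ennreal)"
      by (auto split: split_indicator)
  qed
  also have "\<dots> = emeasure lborel C + emeasure lborel J"
    by (subst nn_integral_add) auto
  also have "emeasure lborel J \<le> ennreal (e / 2)"
  proof (cases "(Inf B + a) / 2 \<le> (Sup A + b) / 2")
    case True
    then show ?thesis unfolding J_def using a b by (simp add: ennreal_leI field_simps)
  next
    case False
    then show ?thesis by (simp add: J_def)
  qed
  also have "2 * (emeasure lborel C + ennreal (e / 2)) = 2 * emeasure lborel C + ennreal e"
    using ennreal_mult[of 2 "e / 2"] e by (simp add: distrib_left)
  finally show "emeasure lborel A + emeasure lborel B \<le> 2 * emeasure lborel C + ennreal e"
    by (auto simp: mult_left_mono)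
qed

text \<open>Truncation to bounded intervals, started late enough that both truncated sets are
  nonempty: the inequality fails for an empty set.\<close>

lemma lborel_midpoint:
  fixes A B C :: "real set"
  assumes [measurable]: "A \<in> sets borel" "B \<in> sets borel" "C \<in> sets borel"
    and ne: "A \<noteq> {}" "B \<noteq> {}"
    and mid: "\<And>a b. a \<in> A \<Longrightarrow> b \<in> B \<Longrightarrow> (a + b) / 2 \<in> C"
  shows "emeasure lborel A + emeasure lborel B \<le> 2 * emeasure lborel C"
proof -
  define I where "I n = {- real n .. real n}" for n
  have I: "incseq I" "(\<Union>n. I n) = UNIV"
    by (auto simp: I_def incseq_def) (metis abs_le_iff minus_le_iff real_arch_simple)
  have lim: "(\<lambda>n. emeasure lborel (S \<inter> I n)) \<longlonglongrightarrow> emeasure lborel S" if [measurable]: "S \<in> sets borel" for S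
  proof -
    have "(\<lambda>n. emeasure lborel (S \<inter> I n)) \<longlonglongrightarrow> emeasure lborel (\<Union>n. S \<inter> I n)"
      using I(1) by (intro Lim_emeasure_incseq) (auto simp: I_def incseq_def)
    also have "(\<Union>n. S \<inter> I n) = S" using I(2) by auto
    finally show ?thesis .
  qed
  obtain a b where ab: "a \<in> A" "b \<in> B" using ne by auto
  obtain N where N: "\<bar>a\<bar> \<le> real N" "\<bar>b\<bar> \<le> real N"
    using real_arch_simple[of "max \<bar>a\<bar> \<bar>b\<bar>"] by auto
  have "emeasure lborel (A \<inter> I n) + emeasure lborel (B \<inter> I n) \<le> 2 * emeasure lborel C" if "n \<ge> N" for n
  proof (rule lborel_midpoint_bounded)
    have "a \<in> I n" "b \<in> I n" using N that by (auto simp: I_def)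
    then show "A \<inter> I n \<noteq> {}" "B \<inter> I n \<noteq> {}" using ab by auto
    show "bdd_above (A \<inter> I n)" by (rule bdd_aboveI[of _ "real n"]) (auto simp: I_def)
    show "bdd_below (B \<inter> I n)" by (rule bdd_belowI[of _ "- real n"]) (auto simp: I_def)
  qed (use mid in \<open>auto simp: I_def\<close>)
  then show ?thesis
    by (intro LIMSEQ_le_const2[OF tendsto_add[OF lim lim]]) auto
qed

text \<open>The layer-cake formula with levels in \<open>(0, 1)\<close>: it is exact for values at
  most 1, and for larger values the cut at level 1 still leaves the inequality in the direction
  needed for \<open>h\<close>.\<close>

lemma emeasure_levels:
  fixes v :: ennreal
  shows "v \<le> 1 \<Longrightarrow> emeasure lborel {t :: real. 0 < t \<and> t < 1 \<and> ennreal t < v} = v"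
    and "emeasure lborel {t :: real. 0 < t \<and> t < 1 \<and> ennreal t \<le> v} \<le> v"
proof -
  assume v: "v \<le> 1"
  then have "v \<noteq> \<top>" by (auto simp: top_unique)
  then obtain r where r: "v = ennreal r" "0 \<le> r" by (cases v) auto
  with v have "r \<le> 1" by simp
  with r have "{t :: real. 0 < t \<and> t < 1 \<and> ennreal t < v} = {0<..<r}"
    by (auto simp: ennreal_less_iff)
  then show "emeasure lborel {t :: real. 0 < t \<and> t < 1 \<and> ennreal t < v} = v" using r by simp
next
  show "emeasure lborel {t :: real. 0 < t \<and> t < 1 \<and> ennreal t \<le> v} \<le> v"
  proof (cases v)
    case (real r)
    then have "{t :: real. 0 < t \<and> t < 1 \<and> ennreal t \<le> v} \<subseteq> {0..r}"
      by (auto simp: ennreal_le_iff)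
    then have "emeasure lborel {t :: real. 0 < t \<and> t < 1 \<and> ennreal t \<le> v} \<le> emeasure lborel {0..r}"
      by (rule emeasure_mono) simp
    then show ?thesis using real by simp
  qed simp
qed

text \<open>Where \<open>f a\<close> and \<open>g b\<close> exceed \<open>t\<close>, the value of
  \<open>h\<close> at the midpoint is at least \<open>t\<close>, so the midpoint inequality applies
  to level sets and is integrated over \<open>t\<close>. Equal suprema ensure that at each level
  below 1 both level sets are nonempty.\<close>

lemma prekopa_leindler_normalised:
  fixes f g h :: "real \<Rightarrow> ennreal"
  assumes [measurable]: "f \<in> borel_measurable borel" "g \<in> borel_measurable borel" "h \<in> borel_measurable borel"
    and sup: "(SUP x. f x) = 1" "(SUP x. g x) = 1"
    and mid: "\<And>x y. f x * g y \<le> (h ((x + y) / 2))\<^sup>2"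
  shows "(\<integral>\<^sup>+x. f x \<partial>lborel) + (\<integral>\<^sup>+x. g x \<partial>lborel) \<le> 2 * (\<integral>\<^sup>+x. h x \<partial>lborel)"
proof -
  have layer: "(\<integral>\<^sup>+x. k x \<partial>lborel) = (\<integral>\<^sup>+t. indicator {0<..<1} t * emeasure lborel {x. ennreal t < k x} \<partial>lborel)"
    if [measurable]: "k \<in> borel_measurable borel" and k: "\<And>x. k x \<le> 1" for k :: "real \<Rightarrow> ennreal"
  proof -
    have "(\<integral>\<^sup>+x. k x \<partial>lborel) = (\<integral>\<^sup>+x. \<integral>\<^sup>+t. indicator {t. 0 < t \<and> t < 1 \<and> ennreal t < k x} t \<partial>lborel \<partial>lborel)"
      using emeasure_levels(1)[OF k] by (intro nn_integral_cong) (subst nn_integral_indicator, auto)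
    also have "\<dots> = (\<integral>\<^sup>+t. \<integral>\<^sup>+x. indicator {t. 0 < t \<and> t < 1 \<and> ennreal t < k x} t \<partial>lborel \<partial>lborel)"
      by (rule lborel_pair.Fubini'[symmetric]) measurable
    also have "\<dots> = (\<integral>\<^sup>+t. \<integral>\<^sup>+x. indicator {0<..<1} t * indicator {x. ennreal t < k x} x \<partial>lborel \<partial>lborel)"
      by (intro nn_integral_cong) (auto split: split_indicator)
    also have "\<dots> = (\<integral>\<^sup>+t. indicator {0<..<1} t * emeasure lborel {x. ennreal t < k x} \<partial>lborel)"
      by (intro nn_integral_cong, subst nn_integral_cmult_indicator) auto
    finally show ?thesis .
  qed
  have le1: "f x \<le> 1" "g x \<le> 1" for x
    using sup SUP_upper[of x UNIV f] SUP_upper[of x UNIV g] by auto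
  have "(\<integral>\<^sup>+x. f x \<partial>lborel) + (\<integral>\<^sup>+x. g x \<partial>lborel)
      = (\<integral>\<^sup>+t. indicator {0<..<1} t * emeasure lborel {x. ennreal t < f x}
         + indicator {0<..<1} t * emeasure lborel {x. ennreal t < g x} \<partial>lborel)"
    using le1 by (simp add: layer nn_integral_add)
  also have "\<dots> \<le> (\<integral>\<^sup>+t. 2 * (indicator {0<..<1} t * emeasure lborel {x. ennreal t \<le> h x}) \<partial>lborel)"
  proof (rule nn_integral_mono)
    fix t :: real
    show "indicator {0<..<1} t * emeasure lborel {x. ennreal t < f x}
         + indicator {0<..<1} t * emeasure lborel {x. ennreal t < g x} \<le> 2 * (indicator {0<..<1} t * emeasure lborel {x. ennreal t \<le> h x})"
    proof (cases "t \<in> {0<..<1}")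
      case True
      have "emeasure lborel {x. ennreal t < f x} + emeasure lborel {x. ennreal t < g x} \<le> 2 * emeasure lborel {x. ennreal t \<le> h x}"
      proof (rule lborel_midpoint)
        have "ennreal t < 1" using True by simp
        then have "ennreal t < (SUP x. f x)" "ennreal t < (SUP x. g x)" by (simp_all only: sup)
        then show "{x. ennreal t < f x} \<noteq> {}" "{x. ennreal t < g x} \<noteq> {}"
          unfolding less_SUP_iff by blast+
        fix a b assume ab: "a \<in> {x. ennreal t < f x}" "b \<in> {x. ennreal t < g x}"
        have "ennreal (t\<^sup>2) = ennreal t * ennreal t" using True by (simp add: power2_eq_square ennreal_mult)
        also have "\<dots> \<le> f a * g b" using ab by (intro mult_mono) auto
        also have "\<dots> \<le> (h ((a + b) / 2))\<^sup>2" by (rule mid)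
        finally have *: "ennreal (t\<^sup>2) \<le> (h ((a + b) / 2))\<^sup>2" .
        have "ennreal t \<le> h ((a + b) / 2)"
        proof (cases "h ((a + b) / 2)")
          case (real r)
          then have "t\<^sup>2 \<le> r\<^sup>2" using * by (simp add: ennreal_power)
          then have "t \<le> r" by (rule power2_le_imp_le) (rule real)
          then show ?thesis unfolding real by (rule ennreal_leI)
        qed simp
        then show "(a + b) / 2 \<in> {x. ennreal t \<le> h x}" by simp
      qed measurable
      then show ?thesis using True by simp
    qed simp
  qed
  also have "\<dots> = 2 * (\<integral>\<^sup>+t. \<integral>\<^sup>+x. indicator {0<..<1} t * indicator {x. ennreal t \<le> h x} x \<partial>lborel \<partial>lborel)"
    by (subst nn_integral_cmult[symmetric]) (auto intro!: nn_integral_cong simp: nn_integral_cmult_indicator)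
  also have "(\<integral>\<^sup>+t. \<integral>\<^sup>+x. indicator {0<..<1} t * indicator {x. ennreal t \<le> h x} x \<partial>lborel \<partial>lborel)
      = (\<integral>\<^sup>+x. \<integral>\<^sup>+t. indicator {0<..<1} t * indicator {x. ennreal t \<le> h x} x \<partial>lborel \<partial>lborel)"
    by (rule lborel_pair.Fubini') measurable
  also have "\<dots> = (\<integral>\<^sup>+x. emeasure lborel {t. 0 < t \<and> t < 1 \<and> ennreal t \<le> h x} \<partial>lborel)"
  proof (rule nn_integral_cong)
    fix x
    have "(\<integral>\<^sup>+t. indicator {0<..<1} t * indicator {x. ennreal t \<le> h x} x \<partial>lborel)
        = (\<integral>\<^sup>+t. indicator {t. 0 < t \<and> t < 1 \<and> ennreal t \<le> h x} t \<partial>lborel)"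
      by (intro nn_integral_cong) (auto split: split_indicator)
    also have "\<dots> = emeasure lborel {t. 0 < t \<and> t < 1 \<and> ennreal t \<le> h x}"
      by (rule nn_integral_indicator) measurable
    finally show "(\<integral>\<^sup>+t. indicator {0<..<1} t * indicator {x. ennreal t \<le> h x} x \<partial>lborel)
        = emeasure lborel {t. 0 < t \<and> t < 1 \<and> ennreal t \<le> h x}" .
  qed
  also have "\<dots> \<le> (\<integral>\<^sup>+x. h x \<partial>lborel)"
    by (intro nn_integral_mono emeasure_levels)
  finally show ?thesis by (auto simp: mult_left_mono)
qed

text \<open>Dividing \<open>f\<close> and \<open>g\<close> by their suprema \<open>a\<close> and
  \<open>b\<close>, and \<open>h\<close> by \<open>sqrt (a * b)\<close>, leads to the normalised
  additive form; the inequality of arithmetic and geometric means turns it into a product. Squaring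
  the side of \<open>h\<close> avoids square roots in \<open>ennreal\<close>.\<close>

lemma prekopa_leindler_lborel:
  fixes f g h :: "real \<Rightarrow> ennreal"
  assumes [measurable]: "f \<in> borel_measurable borel" "g \<in> borel_measurable borel" "h \<in> borel_measurable borel"
    and bound: "\<And>x. f x \<le> 1" "\<And>x. g x \<le> 1"
    and mid: "\<And>x y. f x * g y \<le> (h ((x + y) / 2))\<^sup>2"
  shows "(\<integral>\<^sup>+x. f x \<partial>lborel) * (\<integral>\<^sup>+x. g x \<partial>lborel) \<le> (\<integral>\<^sup>+x. h x \<partial>lborel)\<^sup>2"
proof -
  have "\<exists>a. (SUP x. k x) = ennreal a \<and> 0 \<le> a" if "\<And>x. k x \<le> 1" for k :: "real \<Rightarrow> ennreal"
  proof -
    have "(SUP x. k x) \<le> 1" using that by (intro SUP_least) auto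
    moreover have "(1 :: ennreal) \<noteq> \<top>" by simp
    ultimately have "(SUP x. k x) \<noteq> \<top>" by (rule neq_top_trans[rotated])
    then show ?thesis by (cases "SUP x. k x") auto
  qed
  from this[of f, OF bound(1)] this[of g, OF bound(2)]
  obtain a b where a: "(SUP x. f x) = ennreal a" "0 \<le> a" and b: "(SUP x. g x) = ennreal b" "0 \<le> b" by auto
  show ?thesis
  proof (cases "a = 0 \<or> b = 0")
    case True
    have "k x = 0" if "(SUP x. k x) = 0" for k :: "real \<Rightarrow> ennreal" and x
      using SUP_upper[of x UNIV k] that by simp
    then have "(\<forall>x. f x = 0) \<or> (\<forall>x. g x = 0)" using True a b by fastforce
    then show ?thesis by auto
  next
    case False
    then have pos: "a > 0" "b > 0" using a b by auto
    define c where "c = sqrt (a * b)"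
    have c: "c > 0" "c\<^sup>2 = a * b" using pos by (auto simp: c_def)
    define I J K where "I = (\<integral>\<^sup>+x. f x \<partial>lborel)" and "J = (\<integral>\<^sup>+x. g x \<partial>lborel)" and "K = (\<integral>\<^sup>+x. h x \<partial>lborel)"
    have "(\<integral>\<^sup>+x. ennreal (1 / a) * f x \<partial>lborel) + (\<integral>\<^sup>+x. ennreal (1 / b) * g x \<partial>lborel)
        \<le> 2 * (\<integral>\<^sup>+x. ennreal (1 / c) * h x \<partial>lborel)"
    proof (rule prekopa_leindler_normalised)
      show "(SUP x. ennreal (1 / a) * f x) = 1"
        using a pos by (simp add: SUP_mult_left_ennreal[symmetric] ennreal_mult[symmetric])
      show "(SUP x. ennreal (1 / b) * g x) = 1"
        using b pos by (simp add: SUP_mult_left_ennreal[symmetric] ennreal_mult[symmetric])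
      fix x y
      have "(1 / a) * (1 / b) = (1 / c)\<^sup>2" using c by (simp add: power_divide)
      then have "ennreal (1 / a) * ennreal (1 / b) = (ennreal (1 / c))\<^sup>2"
        using pos c by (simp add: ennreal_mult[symmetric] ennreal_power)
      then have "(ennreal (1 / a) * f x) * (ennreal (1 / b) * g y) = (ennreal (1 / c))\<^sup>2 * (f x * g y)"
        by (simp only: ac_simps)
      also have "\<dots> \<le> (ennreal (1 / c))\<^sup>2 * (h ((x + y) / 2))\<^sup>2" by (intro mult_left_mono mid) simp
      also have "\<dots> = (ennreal (1 / c) * h ((x + y) / 2))\<^sup>2" by (simp only: power_mult_distrib)
      finally show "(ennreal (1 / a) * f x) * (ennreal (1 / b) * g y) \<le> (ennreal (1 / c) * h ((x + y) / 2))\<^sup>2" .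
    qed measurable
    then have *: "ennreal (1 / a) * I + ennreal (1 / b) * J \<le> 2 * (ennreal (1 / c) * K)"
      by (simp add: nn_integral_cmult I_def J_def K_def)
    have "I * J \<le> K\<^sup>2"
    proof (cases K)
      case (real k)
      have "2 * (ennreal (1 / c) * K) = ennreal (2 * (k / c))"
        using ennreal_mult[of 2 "k / c"] ennreal_mult[of "1 / c" k] real c by simp
      then have fin: "ennreal (1 / a) * I + ennreal (1 / b) * J \<le> ennreal (2 * (k / c))" using * by simp
      then have "ennreal (1 / a) * I + ennreal (1 / b) * J < \<infinity>" by (rule le_less_trans) simp
      then have "I < \<infinity>" "J < \<infinity>" using pos by (auto simp: ennreal_mult_less_top ennreal_zero_less_divide)
      then obtain i j where i: "I = ennreal i" "0 \<le> i" and j: "J = ennreal j" "0 \<le> j"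
        by (cases I; cases J) auto
      have "ennreal (i / a + j / b) \<le> ennreal (2 * (k / c))"
        using fin pos i j by (simp add: ennreal_mult[symmetric] ennreal_plus[symmetric] del: ennreal_plus)
      then have le: "i / a + j / b \<le> 2 * (k / c)" using real c by (simp add: ennreal_le_iff)
      \<comment> \<open>Arithmetic against geometric mean; the factor
        \<open>c\<^sup>2 = a * b\<close> then cancels the normalisation.\<close>
      have "4 * ((i / a) * (j / b)) \<le> (i / a + j / b)\<^sup>2"
        using zero_le_power2[of "i / a - j / b"] by (simp add: power2_sum power2_diff)
      also have "\<dots> \<le> (2 * (k / c))\<^sup>2" using le i j pos by (intro power_mono) auto
      also have "\<dots> = 4 * (k\<^sup>2 / (a * b))" using c by (simp add: power_mult_distrib power_divide)
      finally have "i * j \<le> k\<^sup>2" using pos by (simp add: field_simps)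
      then show ?thesis using i j real by (simp add: ennreal_mult[symmetric] ennreal_power)
    qed (simp add: power2_eq_square)
    then show ?thesis by (simp only: I_def J_def K_def)
  qed
qed

text \<open>The normal density is log-concave and at most 1, so multiplying each function by it
  preserves the midpoint condition and the bounds required for Lebesgue measure.\<close>

lemma prekopa_leindler_std_normal:
  fixes F G H :: "real \<Rightarrow> ennreal"
  assumes [measurable]: "F \<in> borel_measurable borel" "G \<in> borel_measurable borel" "H \<in> borel_measurable borel"
    and bound: "\<And>x. F x \<le> 1" "\<And>x. G x \<le> 1"
    and mid: "\<And>x y. F x * G y \<le> (H ((x + y) / 2))\<^sup>2"
  shows "(\<integral>\<^sup>+x. F x \<partial>std_normal_distribution) * (\<integral>\<^sup>+x. G x \<partial>std_normal_distribution)
    \<le> (\<integral>\<^sup>+x. H x \<partial>std_normal_distribution)\<^sup>2"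
proof -
  let ?d = "\<lambda>x. ennreal (std_normal_density x)"
  have d1: "std_normal_density t \<le> 1" for t
  proof -
    have "1 \<le> sqrt (2 * pi)" using pi_gt3 by simp
    then have "1 / sqrt (2 * pi) * exp (- t\<^sup>2 / 2) \<le> 1 * 1" by (intro mult_mono) auto
    then show ?thesis by (simp add: std_normal_density_def)
  qed
  have d2: "?d x * ?d y \<le> (?d ((x + y) / 2))\<^sup>2" for x y
  proof -
    have "exp (- x\<^sup>2 / 2) * exp (- y\<^sup>2 / 2) = exp (- x\<^sup>2 / 2 + - y\<^sup>2 / 2)" by (rule exp_add[symmetric])
    also have "\<dots> \<le> exp (- ((x + y) / 2)\<^sup>2 / 2 + - ((x + y) / 2)\<^sup>2 / 2)"
      using zero_le_power2[of "x - y"] by (simp add: power2_eq_square field_simps)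
    also have "\<dots> = (exp (- ((x + y) / 2)\<^sup>2 / 2))\<^sup>2" by (simp only: exp_add power2_eq_square)
    finally have "(1 / sqrt (2 * pi))\<^sup>2 * (exp (- x\<^sup>2 / 2) * exp (- y\<^sup>2 / 2)) \<le> (1 / sqrt (2 * pi))\<^sup>2 * (exp (- ((x + y) / 2)\<^sup>2 / 2))\<^sup>2"
      by (intro mult_left_mono) auto
    then have "std_normal_density x * std_normal_density y \<le> (std_normal_density ((x + y) / 2))\<^sup>2"
      unfolding std_normal_density_def power_mult_distrib by (simp only: power2_eq_square ac_simps)
    then show ?thesis by (simp add: ennreal_mult[symmetric] ennreal_power ennreal_leI)
  qed
  have "(\<integral>\<^sup>+x. ?d x * F x \<partial>lborel) * (\<integral>\<^sup>+x. ?d x * G x \<partial>lborel) \<le> (\<integral>\<^sup>+x. ?d x * H x \<partial>lborel)\<^sup>2"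
  proof (rule prekopa_leindler_lborel)
    show "?d x * F x \<le> 1" "?d x * G x \<le> 1" for x
      using mult_mono[OF ennreal_leI[OF d1] bound(1), of x x] mult_mono[OF ennreal_leI[OF d1] bound(2), of x x] by auto
    fix x y
    have "(?d x * F x) * (?d y * G y) = (?d x * ?d y) * (F x * G y)" by (simp only: ac_simps)
    also have "\<dots> \<le> (?d ((x + y) / 2))\<^sup>2 * (H ((x + y) / 2))\<^sup>2" by (intro mult_mono d2 mid) auto
    finally show "(?d x * F x) * (?d y * G y) \<le> (?d ((x + y) / 2) * H ((x + y) / 2))\<^sup>2"
      by (simp only: power_mult_distrib)
  qed measurable
  then show ?thesis by (simp add: nn_integral_density)
qed

section \<open>Anderson's inequality for balls\<close>

lemma L2_norm_distr:
  assumes "\<phi> \<in> measurable M N" "g \<in> borel_measurable N"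
  shows "L2_norm (distr M N \<phi>) g = L2_norm M (\<lambda>x. g (\<phi> x))"
  unfolding L2_norm_def using assms by (subst integral_distr) auto

context centred_gaussian
begin

lemma functional_zero_AE: "L2_norm \<gamma> (blinfun_apply f) = 0 \<Longrightarrow> AE y in \<gamma>. f y = 0"
  by (rule L2_norm_eq_0_AE[OF functional_square_integrable])

text \<open>With \<open>h = R f / \<sigma>\<close>, where \<open>\<sigma>\<close> is the standard deviation of \<open>f\<close>, the vector
  \<open>y - (f y / \<sigma>) h\<close> is uncorrelated with, and hence independent of, the normal variable \<open>f y / \<sigma>\<close>.\<close>

lemma split_along_functional:
  fixes f :: "'a \<Rightarrow>\<^sub>L real"
  assumes pos: "L2_norm \<gamma> f > 0"
  obtains \<gamma>' h where "centred_gaussian \<gamma>'" "f h = L2_norm \<gamma> f" "AE y in \<gamma>'. f y = 0"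
    "\<And>g :: 'a \<Rightarrow>\<^sub>L real. AE y in \<gamma>. blinfun_apply g y = 0 \<Longrightarrow> AE y in \<gamma>'. blinfun_apply g y = 0"
    "\<gamma> = distr (\<gamma>' \<Otimes>\<^sub>M std_normal_distribution) borel (\<lambda>(y, t). y + t *\<^sub>R h)"
proof -
  define s where "s = L2_norm \<gamma> f"
  have s: "s > 0" using pos by (simp add: s_def)
  define h where "h = (1 / s) *\<^sub>R R_op \<gamma> f"
  define \<pi> where "\<pi> y = y - (f y / s) *\<^sub>R h" for y
  have \<pi>_meas[measurable]: "\<pi> \<in> measurable borel borel" unfolding \<pi>_def by measurable
  define \<gamma>' where "\<gamma>' = distr \<gamma> borel \<pi>"
  have gh: "blinfun_apply g h = (LINT y|\<gamma>. f y * g y) / s" for g :: "'a \<Rightarrow>\<^sub>L real"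
    unfolding h_def blinfun.scaleR_right R_op_apply[OF functional_square_integrable] by simp
  have "(LINT y|\<gamma>. f y * f y) = s\<^sup>2"
    unfolding s_def L2_norm_power2 by (simp add: power2_eq_square)
  then have fh: "f h = s" using s unfolding gh by (simp add: power2_eq_square)
  \<comment> \<open>The adjoint of \<open>\<pi>\<close>: a functional evaluated at
    \<open>\<pi> y\<close> is another functional evaluated at \<open>y\<close>, so
    \<open>\<gamma>'\<close> inherits being Gaussian and centred, and \<open>p f = 0\<close> makes
    \<open>f\<close> vanish under it.\<close>
  define p :: "('a \<Rightarrow>\<^sub>L real) \<Rightarrow> ('a \<Rightarrow>\<^sub>L real)" where "p g = g - (g h / s) *\<^sub>R f" for g
  have g\<pi>: "blinfun_apply g (\<pi> y) = blinfun_apply (p g) y" for g y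
    by (simp add: \<pi>_def p_def blinfun.bilinear_simps)
  interpret \<gamma>': prob_space \<gamma>' unfolding \<gamma>'_def by (rule prob_space_distr) simp
  have "centred_gaussian \<gamma>'"
  proof
    have law: "distr \<gamma>' borel (blinfun_apply g) = distr \<gamma> borel (p g)" for g :: "'a \<Rightarrow>\<^sub>L real"
      unfolding \<gamma>'_def by (subst distr_distr) (auto simp: comp_def g\<pi>)
    show "gaussian_measure \<gamma>'"
      using gaussian \<gamma>'.prob_space_axioms law by (auto simp: gaussian_measure_def \<gamma>'_def)
    show "centred_measure \<gamma>'"
      using centred unfolding centred_measure_def \<gamma>'_def by (subst integral_distr) (auto simp: g\<pi>)
  qed
  then interpret G: centred_gaussian \<gamma>' .
  interpret N: real_distribution std_normal_distribution by (rule real_dist_normal_dist)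
  interpret P: pair_prob_space \<gamma>' std_normal_distribution ..
  have AE': "AE y in \<gamma>'. blinfun_apply g y = 0" if "AE y in \<gamma>. blinfun_apply (p g) y = 0" for g
    unfolding \<gamma>'_def using that by (subst AE_distr_iff) (auto simp: g\<pi>)
  have "p f = 0" using s fh by (simp add: p_def)
  then have f0: "AE y in \<gamma>'. f y = 0" by (intro AE') simp
  \<comment> \<open>A functional that vanishes almost surely has covariance zero with
    \<open>f\<close>, so \<open>p\<close> fixes it. The later induction relies on functionals
    already split off remaining null.\<close>
  have g0: "AE y in \<gamma>'. blinfun_apply g y = 0" if g: "AE y in \<gamma>. blinfun_apply g y = 0" for g :: "'a \<Rightarrow>\<^sub>L real"
  proof (rule AE')
    have "AE y in \<gamma>. f y * g y = 0" using g by eventually_elim simp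
    then have "(LINT y|\<gamma>. f y * g y) = 0" by (rule integral_eq_zero_AE)
    then have "p g = g" by (simp add: p_def gh)
    then show "AE y in \<gamma>. blinfun_apply (p g) y = 0" using g by simp
  qed
  \<comment> \<open>Pythagoras in L2: \<open>g\<close> minus its projection
    \<open>(g h / s) f\<close> is orthogonal to \<open>f\<close>, and the projection has norm
    \<open>\<bar>g h\<bar>\<close>.\<close>
  have var: "(L2_norm \<gamma> (blinfun_apply g))\<^sup>2 = (L2_norm \<gamma>' (blinfun_apply g))\<^sup>2 + (g h)\<^sup>2" for g :: "'a \<Rightarrow>\<^sub>L real"
  proof -
    have "L2_norm \<gamma>' (blinfun_apply g) = L2_norm \<gamma> (\<lambda>y. blinfun_apply g y - (g h / s) * f y)"
      unfolding \<gamma>'_def by (subst L2_norm_distr) (auto simp: g\<pi> p_def blinfun.bilinear_simps)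
    moreover have inner: "(LINT y|\<gamma>. g y * (g h / s * f y)) = g h / s * (LINT y|\<gamma>. f y * g y)"
      unfolding integral_mult_right_zero[symmetric] by (intro Bochner_Integration.integral_cong) auto
    ultimately have "(L2_norm \<gamma>' (blinfun_apply g))\<^sup>2
        = (L2_norm \<gamma> (blinfun_apply g))\<^sup>2 - 2 * ((g h / s) * (LINT y|\<gamma>. f y * g y)) + (g h / s)\<^sup>2 * s\<^sup>2"
      using inner
      by (simp only: L2_norm_diff_power2[OF functional_square_integrable square_integrable_scale[OF functional_square_integrable]]
          L2_norm_scale power_mult_distrib power2_abs s_def)
    also have "(LINT y|\<gamma>. f y * g y) = s * g h" using s by (simp add: gh)
    finally show ?thesis using s by (simp add: power2_eq_square)
  qed
  have [measurable]: "(\<lambda>(y, t). y + t *\<^sub>R h) \<in> borel_measurable (\<gamma>' \<Otimes>\<^sub>M std_normal_distribution)"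
    by measurable
  \<comment> \<open>Independence is encoded in the product measure: its characteristic functional
    factorises, and the variance identity makes the product equal to that of
    \<open>\<gamma>\<close>.\<close>
  have "\<gamma> = distr (\<gamma>' \<Otimes>\<^sub>M std_normal_distribution) borel (\<lambda>(y, t). y + t *\<^sub>R h)" (is "_ = ?D")
  proof (rule measure_eqI_char)
    interpret D: prob_space ?D by (rule P.prob_space_distr) simp
    show "finite_measure ?D" by (rule D.finite_measure)
    show "finite_measure \<gamma>" by (rule finite_measure)
    fix g :: "'a \<Rightarrow>\<^sub>L real"
    have "(CLINT y|?D. iexp (blinfun_apply g y))
        = (CLINT z|\<gamma>' \<Otimes>\<^sub>M std_normal_distribution. iexp (blinfun_apply g (fst z)) * iexp (blinfun_apply g h * snd z))"
      by (subst integral_distr)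
        (auto simp: blinfun.bilinear_simps exp_add[symmetric] algebra_simps case_prod_beta intro!: Bochner_Integration.integral_cong)
    also have "\<dots> = (CLINT y|\<gamma>'. CLINT t|std_normal_distribution. iexp (blinfun_apply g y) * iexp (blinfun_apply g h * t))"
      by (subst P.integral_fst'[symmetric]) (auto intro!: P.integrable_const_bound[where B = 1] simp: norm_mult)
    also have "\<dots> = (CLINT y|\<gamma>'. iexp (blinfun_apply g y)) * complex_of_real (exp (- ((g h)\<^sup>2) / 2))"
      by (simp only: integral_mult_right_zero integral_mult_left_zero std_normal_iexp)
    also have "\<dots> = complex_of_real (exp (- ((L2_norm \<gamma>' (blinfun_apply g))\<^sup>2) / 2) * exp (- ((g h)\<^sup>2) / 2))"
      by (simp only: G.char_functional of_real_mult)
    also have "exp (- ((L2_norm \<gamma>' (blinfun_apply g))\<^sup>2) / 2) * exp (- ((g h)\<^sup>2) / 2) = exp (- ((L2_norm \<gamma> (blinfun_apply g))\<^sup>2) / 2)"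
      by (simp only: exp_add[symmetric] var) (simp add: field_simps)
    finally show "(CLINT y|\<gamma>. iexp (blinfun_apply g y)) = (CLINT y|?D. iexp (blinfun_apply g y))"
      by (simp only: char_functional)
  qed simp_all
  with \<open>centred_gaussian \<gamma>'\<close> fh f0 g0 show thesis
    by (intro that[of \<gamma>' h]) (auto simp: s_def)
qed

text \<open>The characteristic functional depends on \<open>g\<close> only through its L2 norm and
  is therefore even.\<close>

lemma distr_uminus: "distr \<gamma> borel uminus = \<gamma>"
proof (rule measure_eqI_char)
  have [measurable]: "uminus \<in> measurable borel (borel :: 'a measure)"
    by (intro borel_measurable_continuous_onI continuous_intros)
  interpret D: prob_space "distr \<gamma> borel uminus" by (rule prob_space_distr) simp
  show "finite_measure (distr \<gamma> borel uminus)" by (rule D.finite_measure)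
  show "finite_measure \<gamma>" by (rule finite_measure)
  fix g :: "'a \<Rightarrow>\<^sub>L real"
  have "(CLINT y|distr \<gamma> borel uminus. iexp (blinfun_apply g y)) = (CLINT y|\<gamma>. iexp (blinfun_apply (- g) y))"
    by (subst integral_distr) (auto simp: blinfun.bilinear_simps)
  also have "\<dots> = (CLINT y|\<gamma>. iexp (blinfun_apply g y))"
    unfolding char_functional by (simp add: L2_norm_def blinfun.bilinear_simps)
  finally show "(CLINT y|distr \<gamma> borel uminus. iexp (blinfun_apply g y)) = (CLINT y|\<gamma>. iexp (blinfun_apply g y))" .
qed simp_all

end

text \<open>Induction on \<open>\<Phi>\<close>, integrating out one functional at a time. The functionals in \<open>\<Theta> - \<Phi>\<close> have
  already been split off and vanish almost surely, while the integrands keep depending on all of \<open>\<Theta>\<close>.\<close>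

lemma prekopa_leindler_cylindrical:
  fixes \<gamma> :: "'a::{banach, second_countable_topology} measure" and F G H :: "'a \<Rightarrow> ennreal"
    and \<Phi> \<Theta> :: "('a \<Rightarrow>\<^sub>L real) set"
  assumes "finite \<Phi>" "finite \<Theta>" "centred_gaussian \<gamma>"
    and "\<forall>f \<in> \<Theta> - \<Phi>. AE y in \<gamma>. blinfun_apply f y = 0"
    and "F \<in> borel_measurable borel" "G \<in> borel_measurable borel" "H \<in> borel_measurable borel"
    and "\<forall>y. F y \<le> 1" "\<forall>y. G y \<le> 1"
    and "\<forall>y y'. (\<forall>f \<in> \<Theta>. blinfun_apply f y = blinfun_apply f y') \<longrightarrow> F y = F y' \<and> G y = G y' \<and> H y = H y'"
    and "\<forall>y y'. F y * G y' \<le> (H ((1 / 2) *\<^sub>R (y + y')))\<^sup>2"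
  shows "(\<integral>\<^sup>+y. F y \<partial>\<gamma>) * (\<integral>\<^sup>+y. G y \<partial>\<gamma>) \<le> (\<integral>\<^sup>+y. H y \<partial>\<gamma>)\<^sup>2"
  using assms(1,3-)
proof (induction \<Phi> arbitrary: \<gamma> F G H rule: finite_induct)
  case empty
  interpret centred_gaussian \<gamma> by fact
  \<comment> \<open>With every functional of \<open>\<Theta>\<close> null, the integrands are almost
    surely equal to their values at the origin, and the claim is the midpoint hypothesis
    there.\<close>
  have "AE y in \<gamma>. \<forall>f\<in>\<Theta>. blinfun_apply f y = 0"
    using empty assms(2) by (intro AE_finite_allI) auto
  then have ae: "AE y in \<gamma>. F y = F 0 \<and> G y = G 0 \<and> H y = H 0"
  proof eventually_elim
    case (elim y)
    then have "\<forall>f\<in>\<Theta>. blinfun_apply f y = blinfun_apply f 0" by simp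
    then show ?case using empty.prems(8) by blast
  qed
  have "(\<integral>\<^sup>+y. F y \<partial>\<gamma>) = (\<integral>\<^sup>+y. F 0 \<partial>\<gamma>)" "(\<integral>\<^sup>+y. G y \<partial>\<gamma>) = (\<integral>\<^sup>+y. G 0 \<partial>\<gamma>)" "(\<integral>\<^sup>+y. H y \<partial>\<gamma>) = (\<integral>\<^sup>+y. H 0 \<partial>\<gamma>)"
    by (rule nn_integral_cong_AE; use ae in eventually_elim; blast)+
  moreover have "F 0 * G 0 \<le> (H 0)\<^sup>2"
    using empty.prems(9)[rule_format, of 0 0] by simp
  ultimately show ?case using emeasure_space_1 by simp
next
  case (insert f \<Phi>)
  interpret centred_gaussian \<gamma> by fact
  note [measurable] = insert.prems(3-5)
  show ?case
  proof (cases "L2_norm \<gamma> f = 0")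
    case True
    \<comment> \<open>A functional of variance zero joins the null ones without changing the
      measure.\<close>
    then have "\<forall>f \<in> \<Theta> - \<Phi>. AE y in \<gamma>. blinfun_apply f y = 0"
      using insert.prems(2) functional_zero_AE by blast
    then show ?thesis using insert.prems by (intro insert.IH) auto
  next
    case False
    then have "L2_norm \<gamma> f > 0" using L2_norm_nonneg[of \<gamma> f] by simp
    then obtain \<gamma>' h where \<gamma>': "centred_gaussian \<gamma>'" "f h = L2_norm \<gamma> f" "AE y in \<gamma>'. f y = 0"
      "\<And>g :: 'a \<Rightarrow>\<^sub>L real. AE y in \<gamma>. blinfun_apply g y = 0 \<Longrightarrow> AE y in \<gamma>'. blinfun_apply g y = 0"
      "\<gamma> = distr (\<gamma>' \<Otimes>\<^sub>M std_normal_distribution) borel (\<lambda>(y, t). y + t *\<^sub>R h)"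
      using split_along_functional[of f] by metis
    interpret G: centred_gaussian \<gamma>' by fact
    interpret N: real_distribution std_normal_distribution by (rule real_dist_normal_dist)
    interpret P: pair_prob_space \<gamma>' std_normal_distribution ..
    have fub: "(\<integral>\<^sup>+y. K y \<partial>\<gamma>) = (\<integral>\<^sup>+y. \<integral>\<^sup>+t. K (y + t *\<^sub>R h) \<partial>std_normal_distribution \<partial>\<gamma>')"
      if [measurable]: "K \<in> borel_measurable borel" for K :: "'a \<Rightarrow> ennreal"
    proof -
      have "(\<integral>\<^sup>+y. K y \<partial>\<gamma>) = (\<integral>\<^sup>+z. K (fst z + snd z *\<^sub>R h) \<partial>(\<gamma>' \<Otimes>\<^sub>M std_normal_distribution))"
        by (subst \<gamma>'(5), subst nn_integral_distr) (auto simp: case_prod_beta)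
      also have "\<dots> = (\<integral>\<^sup>+y. \<integral>\<^sup>+t. K (y + t *\<^sub>R h) \<partial>std_normal_distribution \<partial>\<gamma>')"
        by (subst N.nn_integral_fst[symmetric]) auto
      finally show ?thesis .
    qed
    have meas: "(\<lambda>y. \<integral>\<^sup>+t. K (y + t *\<^sub>R h) \<partial>std_normal_distribution) \<in> borel_measurable borel"
      if [measurable]: "K \<in> borel_measurable borel" for K :: "'a \<Rightarrow> ennreal"
      by measurable
    have le1: "(\<integral>\<^sup>+t. K (y + t *\<^sub>R h) \<partial>std_normal_distribution) \<le> 1" if "\<forall>y. K y \<le> 1" for K :: "'a \<Rightarrow> ennreal" and y
    proof -
      have "(\<integral>\<^sup>+t. K (y + t *\<^sub>R h) \<partial>std_normal_distribution) \<le> (\<integral>\<^sup>+t. 1 \<partial>std_normal_distribution)"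
        using that by (intro nn_integral_mono) auto
      also have "\<dots> = 1" using N.emeasure_space_1 by simp
      finally show ?thesis .
    qed
    show ?thesis
      unfolding fub[OF insert.prems(3)] fub[OF insert.prems(4)] fub[OF insert.prems(5)]
    proof (rule insert.IH)
      show "\<forall>f \<in> \<Theta> - \<Phi>. AE y in \<gamma>'. blinfun_apply f y = 0"
        using insert.prems(2) \<gamma>'(3,4) by blast
      show "\<forall>y y'. (\<forall>f \<in> \<Theta>. blinfun_apply f y = blinfun_apply f y') \<longrightarrow>
          (\<integral>\<^sup>+t. F (y + t *\<^sub>R h) \<partial>std_normal_distribution) = (\<integral>\<^sup>+t. F (y' + t *\<^sub>R h) \<partial>std_normal_distribution) \<and>
          (\<integral>\<^sup>+t. G (y + t *\<^sub>R h) \<partial>std_normal_distribution) = (\<integral>\<^sup>+t. G (y' + t *\<^sub>R h) \<partial>std_normal_distribution) \<and>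
          (\<integral>\<^sup>+t. H (y + t *\<^sub>R h) \<partial>std_normal_distribution) = (\<integral>\<^sup>+t. H (y' + t *\<^sub>R h) \<partial>std_normal_distribution)"
      proof (intro allI impI)
        fix y y' assume "\<forall>f \<in> \<Theta>. blinfun_apply f y = blinfun_apply f y'"
        then have "\<forall>f \<in> \<Theta>. blinfun_apply f (y + t *\<^sub>R h) = blinfun_apply f (y' + t *\<^sub>R h)" for t
          by (simp add: blinfun.bilinear_simps)
        then have "F (y + t *\<^sub>R h) = F (y' + t *\<^sub>R h) \<and> G (y + t *\<^sub>R h) = G (y' + t *\<^sub>R h) \<and> H (y + t *\<^sub>R h) = H (y' + t *\<^sub>R h)" for t
          using insert.prems(8) by blast
        then show "(\<integral>\<^sup>+t. F (y + t *\<^sub>R h) \<partial>std_normal_distribution) = (\<integral>\<^sup>+t. F (y' + t *\<^sub>R h) \<partial>std_normal_distribution) \<and>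
          (\<integral>\<^sup>+t. G (y + t *\<^sub>R h) \<partial>std_normal_distribution) = (\<integral>\<^sup>+t. G (y' + t *\<^sub>R h) \<partial>std_normal_distribution) \<and>
          (\<integral>\<^sup>+t. H (y + t *\<^sub>R h) \<partial>std_normal_distribution) = (\<integral>\<^sup>+t. H (y' + t *\<^sub>R h) \<partial>std_normal_distribution)"
          by (simp only: simp_thms)
      qed
      \<comment> \<open>Midpoints of points on the lines through \<open>y\<close> and
        \<open>y'\<close> in direction \<open>h\<close> lie on the line through the midpoint, so the
        one-dimensional inequality passes the hypothesis on to the fibre integrals.\<close>
      show "\<forall>y y'. (\<integral>\<^sup>+t. F (y + t *\<^sub>R h) \<partial>std_normal_distribution) * (\<integral>\<^sup>+t. G (y' + t *\<^sub>R h) \<partial>std_normal_distribution)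
          \<le> (\<integral>\<^sup>+t. H ((1 / 2) *\<^sub>R (y + y') + t *\<^sub>R h) \<partial>std_normal_distribution)\<^sup>2"
      proof (intro allI prekopa_leindler_std_normal)
        fix y y' and s t :: real
        have "(1 / 2) *\<^sub>R ((y + s *\<^sub>R h) + (y' + t *\<^sub>R h)) = (1 / 2) *\<^sub>R (y + y') + ((s + t) / 2) *\<^sub>R h"
          by (simp add: algebra_simps add_divide_distrib)
        then show "F (y + s *\<^sub>R h) * G (y' + t *\<^sub>R h) \<le> (H ((1 / 2) *\<^sub>R (y + y') + ((s + t) / 2) *\<^sub>R h))\<^sup>2"
          using insert.prems(9)[rule_format, of "y + s *\<^sub>R h" "y' + t *\<^sub>R h"] by simp
      qed (use insert.prems in auto)
    qed (use insert.prems \<gamma>'(1) meas le1 in auto)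
  qed
qed

context centred_gaussian
begin

text \<open>Prekopa--Leindler for the indicators of the sets centred at \<open>z\<close>,
  \<open>- z\<close> and the origin: a midpoint of the first two lies in the third. Symmetry of
  \<open>\<gamma>\<close> makes the first two measures equal, so the product is a square. It is
  applied to finite intersections of slabs, which decrease to the ball.\<close>

theorem anderson_cball: "measure \<gamma> (cball z r) \<le> measure \<gamma> (cball 0 r)"
proof -
  obtain f :: "nat \<Rightarrow> ('a \<Rightarrow>\<^sub>L real)" where f: "\<And>y r. norm y \<le> r \<longleftrightarrow> (\<forall>i. \<bar>f i y\<bar> \<le> r)"
    using countable_norming_family by blast
  define C where "C n z = {y. \<forall>i<n. \<bar>f i (y - z)\<bar> \<le> r}" for n :: nat and z
  have C[measurable]: "C n z \<in> sets borel" for n z unfolding C_def by measurable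
  have lim: "(\<lambda>n. measure \<gamma> (C n z)) \<longlonglongrightarrow> measure \<gamma> (cball z r)" for z
  proof -
    have "(\<lambda>n. measure \<gamma> (C n z)) \<longlonglongrightarrow> measure \<gamma> (\<Inter>n. C n z)"
      by (intro finite_Lim_measure_decseq) (auto simp: C_def decseq_def)
    also have "(\<Inter>n. C n z) = cball z r"
      by (auto simp: C_def dist_norm norm_minus_commute[of z] f) (use lessI in blast)
    finally show ?thesis .
  qed
  have "measure \<gamma> (C n z) \<le> measure \<gamma> (C n 0)" for n
  proof -
    have "(\<integral>\<^sup>+y. indicator (C n z) y \<partial>\<gamma>) * (\<integral>\<^sup>+y. indicator (C n (- z)) y \<partial>\<gamma>) \<le> (\<integral>\<^sup>+y. indicator (C n 0) y \<partial>\<gamma>)\<^sup>2"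
    proof (rule prekopa_leindler_cylindrical[where \<Phi> = "f ` {..<n}" and \<Theta> = "f ` {..<n}"])
      show "\<forall>y y'. indicator (C n z) y * indicator (C n (- z)) y' \<le> (indicator (C n 0) ((1 / 2) *\<^sub>R (y + y')) :: ennreal)\<^sup>2"
      proof (intro allI)
        fix y y'
        have "(1 / 2) *\<^sub>R (y + y') \<in> C n 0" if yy: "y \<in> C n z" "y' \<in> C n (- z)"
          unfolding C_def
        proof (intro CollectI allI impI)
          fix i assume "i < n"
          then have "\<bar>f i (y - z)\<bar> \<le> r" "\<bar>f i (y' - - z)\<bar> \<le> r" using yy by (auto simp: C_def)
          then show "\<bar>f i ((1 / 2) *\<^sub>R (y + y') - 0)\<bar> \<le> r"
            by (simp add: blinfun.bilinear_simps abs_le_iff)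
        qed
        then show "indicator (C n z) y * indicator (C n (- z)) y' \<le> (indicator (C n 0) ((1 / 2) *\<^sub>R (y + y')) :: ennreal)\<^sup>2"
          by (auto split: split_indicator)
      qed
      show "\<forall>y y'. (\<forall>g\<in>f ` {..<n}. blinfun_apply g y = blinfun_apply g y') \<longrightarrow>
          indicator (C n z) y = (indicator (C n z) y' :: ennreal) \<and> indicator (C n (- z)) y = (indicator (C n (- z)) y' :: ennreal)
          \<and> indicator (C n 0) y = (indicator (C n 0) y' :: ennreal)"
        by (auto simp: C_def indicator_def blinfun.bilinear_simps)
    qed (auto split: split_indicator intro: centred_gaussian_axioms)
    then have "emeasure \<gamma> (C n z) * emeasure \<gamma> (C n (- z)) \<le> (emeasure \<gamma> (C n 0))\<^sup>2" by simp
    then have "measure \<gamma> (C n z) * measure \<gamma> (C n (- z)) \<le> (measure \<gamma> (C n 0))\<^sup>2"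
      by (simp add: emeasure_eq_measure ennreal_mult[symmetric] ennreal_power)
    moreover have "measure \<gamma> (C n (- z)) = measure \<gamma> (C n z)"
    proof -
      have [measurable]: "uminus \<in> measurable borel (borel :: 'a measure)"
        by (intro borel_measurable_continuous_onI continuous_intros)
      have "measure \<gamma> (C n (- z)) = measure (distr \<gamma> borel uminus) (C n (- z))" by (simp only: distr_uminus)
      also have "\<dots> = measure \<gamma> (uminus -` C n (- z) \<inter> space \<gamma>)" by (rule measure_distr) auto
      also have "uminus -` C n (- z) \<inter> space \<gamma> = C n z"
        by (auto simp: C_def blinfun.bilinear_simps abs_minus_commute)
      finally show ?thesis .
    qed
    ultimately have "(measure \<gamma> (C n z))\<^sup>2 \<le> (measure \<gamma> (C n 0))\<^sup>2" by (simp add: power2_eq_square)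
    then show ?thesis by (rule power2_le_imp_le) simp
  qed
  then show ?thesis by (intro LIMSEQ_le[OF lim lim]) auto
qed

end

section \<open>Balls and the Cameron--Martin norm\<close>

lemma integral_mult_self: "(LINT x|M. f x * f x) = (L2_norm M f)\<^sup>2"
  unfolding L2_norm_power2 by (simp only: power2_eq_square)

context centred_gaussian
begin

lemma measure_cball_le_of_functional:
  fixes f :: "'a \<Rightarrow>\<^sub>L real"
  assumes pos: "L2_norm \<gamma> f > 0" and \<rho>: "\<rho> \<ge> 0"
    and low: "\<And>y. y \<in> cball x r \<Longrightarrow> \<rho> * L2_norm \<gamma> f \<le> f y"
  shows "measure \<gamma> (cball x r) \<le> exp (- (1 / 2 * \<rho>\<^sup>2)) * measure \<gamma> (cball 0 r)"
proof -
  let ?N = std_normal_distribution and ?d = "\<lambda>t. ennreal (std_normal_density t)"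
  let ?e = "ennreal (exp (- (1 / 2 * \<rho>\<^sup>2)))"
  obtain \<gamma>' h where \<gamma>': "centred_gaussian \<gamma>'" "f h = L2_norm \<gamma> f" "AE y in \<gamma>'. f y = 0"
    "\<gamma> = distr (\<gamma>' \<Otimes>\<^sub>M ?N) borel (\<lambda>(y, t). y + t *\<^sub>R h)"
    using split_along_functional[OF pos] by metis
  interpret G: centred_gaussian \<gamma>' by fact
  interpret N: real_distribution ?N by (rule real_dist_normal_dist)
  interpret P: pair_prob_space \<gamma>' ?N ..
  have em: "emeasure \<gamma> B = (\<integral>\<^sup>+y. \<integral>\<^sup>+t. ?d t * indicator B (y + t *\<^sub>R h) \<partial>lborel \<partial>\<gamma>')"
    if [measurable]: "B \<in> sets borel" for B
  proof -
    have "emeasure \<gamma> B = (\<integral>\<^sup>+y. indicator B y \<partial>\<gamma>)" by simp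
    also have "\<dots> = (\<integral>\<^sup>+z. indicator B (fst z + snd z *\<^sub>R h) \<partial>(\<gamma>' \<Otimes>\<^sub>M ?N))"
      by (subst \<gamma>'(4), subst nn_integral_distr) (auto simp: case_prod_beta)
    also have "\<dots> = (\<integral>\<^sup>+y. \<integral>\<^sup>+t. indicator B (y + t *\<^sub>R h) \<partial>?N \<partial>\<gamma>')"
      by (subst N.nn_integral_fst[symmetric]) auto
    also have "\<dots> = (\<integral>\<^sup>+y. \<integral>\<^sup>+t. ?d t * indicator B (y + t *\<^sub>R h) \<partial>lborel \<partial>\<gamma>')"
      by (intro nn_integral_cong nn_integral_density) auto
    finally show ?thesis .
  qed
  have cmult: "(\<integral>\<^sup>+y. \<integral>\<^sup>+s. ?e * (?d s * indicator B (y + s *\<^sub>R h)) \<partial>lborel \<partial>\<gamma>')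
      = ?e * (\<integral>\<^sup>+y. \<integral>\<^sup>+s. ?d s * indicator B (y + s *\<^sub>R h) \<partial>lborel \<partial>\<gamma>')"
    if [measurable]: "B \<in> sets borel" for B
    by (simp add: nn_integral_cmult)
  \<comment> \<open>Writing \<open>t = \<rho> + s\<close> turns the condition for the ball around
    \<open>x\<close> into the one for the ball around \<open>z\<close>. The position of
    \<open>z\<close> is irrelevant, since Anderson's inequality bounds all centres.\<close>
  define z where "z = x - \<rho> *\<^sub>R h"
  have shift: "y + (\<rho> + s) *\<^sub>R h \<in> cball x r \<longleftrightarrow> y + s *\<^sub>R h \<in> cball z r" for y s
  proof -
    have "x - (y + (\<rho> + s) *\<^sub>R h) = z - (y + s *\<^sub>R h)" by (simp add: z_def algebra_simps)
    then show ?thesis by (simp only: mem_cball dist_norm)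
  qed
  have "emeasure \<gamma> (cball x r) = (\<integral>\<^sup>+y. \<integral>\<^sup>+t. ?d t * indicator (cball x r) (y + t *\<^sub>R h) \<partial>lborel \<partial>\<gamma>')"
    by (rule em) simp
  also have "\<dots> = (\<integral>\<^sup>+y. \<integral>\<^sup>+s. ?d (\<rho> + s) * indicator (cball x r) (y + (\<rho> + s) *\<^sub>R h) \<partial>lborel \<partial>\<gamma>')"
  proof (rule nn_integral_cong)
    fix y
    have m: "(\<lambda>t. ?d t * indicator B (y + t *\<^sub>R h)) \<in> borel_measurable borel"
      if [measurable]: "B \<in> sets borel" for B by measurable
    show "(\<integral>\<^sup>+t. ?d t * indicator (cball x r) (y + t *\<^sub>R h) \<partial>lborel)
        = (\<integral>\<^sup>+s. ?d (\<rho> + s) * indicator (cball x r) (y + (\<rho> + s) *\<^sub>R h) \<partial>lborel)"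
      using nn_integral_real_affine[OF m[of "cball x r"], of 1 \<rho>] by simp
  qed
  also have "\<dots> \<le> (\<integral>\<^sup>+y. \<integral>\<^sup>+s. ?e * (?d s * indicator (cball z r) (y + s *\<^sub>R h)) \<partial>lborel \<partial>\<gamma>')"
  proof (rule nn_integral_mono_AE)
    show "AE y in \<gamma>'. (\<integral>\<^sup>+s. ?d (\<rho> + s) * indicator (cball x r) (y + (\<rho> + s) *\<^sub>R h) \<partial>lborel)
        \<le> (\<integral>\<^sup>+s. ?e * (?d s * indicator (cball z r) (y + s *\<^sub>R h)) \<partial>lborel)"
      using \<gamma>'(3)
    proof eventually_elim
      case (elim y)
      show ?case
      proof (rule nn_integral_mono)
        fix s :: real
        show "?d (\<rho> + s) * indicator (cball x r) (y + (\<rho> + s) *\<^sub>R h) \<le> ?e * (?d s * indicator (cball z r) (y + s *\<^sub>R h))"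
        proof (cases "y + (\<rho> + s) *\<^sub>R h \<in> cball x r")
          case True
          \<comment> \<open>As \<open>f y = 0\<close> almost surely and \<open>f h\<close> is the
            standard deviation, the value of \<open>f\<close> at the point is
            \<open>(\<rho> + s)\<close> times that deviation.\<close>
          have "\<rho> * L2_norm \<gamma> f \<le> (\<rho> + s) * L2_norm \<gamma> f"
            using low[OF True] elim \<gamma>'(2) by (simp add: blinfun.bilinear_simps)
          then have s: "0 \<le> s" using pos by simp
          \<comment> \<open>Expanding \<open>(\<rho> + s)\<^sup>2\<close> leaves the cross term
            \<open>exp (- (\<rho> * s))\<close>, which is at most 1 because both factors are
            nonnegative.\<close>
          have "std_normal_density (\<rho> + s) = exp (- (1 / 2 * \<rho>\<^sup>2)) * (std_normal_density s * exp (- (\<rho> * s)))"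
            by (simp add: std_normal_density_def exp_add[symmetric]) (simp add: power2_eq_square field_simps)
          also have "\<dots> \<le> exp (- (1 / 2 * \<rho>\<^sup>2)) * (std_normal_density s * 1)"
            using s \<rho> by (intro mult_left_mono) auto
          finally have "?d (\<rho> + s) \<le> ?e * ?d s" by (simp add: ennreal_mult[symmetric] ennreal_leI)
          then show ?thesis using True shift[of y s] by simp
        qed simp
      qed
    qed
  qed
  also have "\<dots> = ?e * (\<integral>\<^sup>+y. \<integral>\<^sup>+s. ?d s * indicator (cball z r) (y + s *\<^sub>R h) \<partial>lborel \<partial>\<gamma>')"
    by (rule cmult) simp
  also have "\<dots> = ?e * emeasure \<gamma> (cball z r)"
    by (simp add: em)
  finally have "measure \<gamma> (cball x r) \<le> exp (- (1 / 2 * \<rho>\<^sup>2)) * measure \<gamma> (cball z r)"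
    by (simp add: emeasure_eq_measure ennreal_mult[symmetric])
  also have "\<dots> \<le> exp (- (1 / 2 * \<rho>\<^sup>2)) * measure \<gamma> (cball 0 r)"
    by (intro mult_left_mono anderson_cball) simp
  finally show ?thesis .
qed

section \<open>The L2 closure of the dual and the Cameron--Martin norm\<close>

lemma dual_L2_closureD: "u \<in> dual_L2_closure \<gamma> \<Longrightarrow> square_integrable \<gamma> u"
  by (simp add: dual_L2_closure_def)

lemma dual_L2_closure_approx:
  assumes "u \<in> dual_L2_closure \<gamma>" "e > 0"
  obtains g :: "'a \<Rightarrow>\<^sub>L real" where "L2_norm \<gamma> (\<lambda>y. u y - g y) < e"
  using assms by (auto simp: dual_L2_closure_def)

lemma dual_L2_closure_limit:
  assumes "square_integrable \<gamma> u"
    and "\<And>e. e > 0 \<Longrightarrow> \<exists>v \<in> dual_L2_closure \<gamma>. L2_norm \<gamma> (\<lambda>y. u y - v y) < e"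
  shows "u \<in> dual_L2_closure \<gamma>"
  unfolding dual_L2_closure_def
proof (intro CollectI conjI allI impI assms(1))
  fix e :: real assume "0 < e"
  then have e: "0 < e / 2" by simp
  obtain v where v: "v \<in> dual_L2_closure \<gamma>" "L2_norm \<gamma> (\<lambda>y. u y - v y) < e / 2" using assms(2)[OF e] by blast
  obtain g :: "'a \<Rightarrow>\<^sub>L real" where g: "L2_norm \<gamma> (\<lambda>y. v y - g y) < e / 2"
    using dual_L2_closure_approx[OF v(1) e] by blast
  have "L2_norm \<gamma> (\<lambda>y. u y - g y) < e"
    using L2_norm_triangle_diff[OF assms(1) dual_L2_closureD[OF v(1)] functional_square_integrable[of g]] v(2) g by simp
  then show "\<exists>g :: 'a \<Rightarrow>\<^sub>L real. square_integrable \<gamma> (blinfun_apply g) \<and> L2_norm \<gamma> (\<lambda>y. u y - g y) < e"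
    using functional_square_integrable by blast
qed

lemma functional_in_dual_L2_closure: "blinfun_apply f \<in> dual_L2_closure \<gamma>"
  using functional_square_integrable
  by (auto simp: dual_L2_closure_def L2_norm_def intro!: exI[of _ f])

lemma dual_L2_closure_scale:
  assumes u: "u \<in> dual_L2_closure \<gamma>"
  shows "(\<lambda>y. c * u y) \<in> dual_L2_closure \<gamma>"
proof (rule dual_L2_closure_limit)
  show "square_integrable \<gamma> (\<lambda>y. c * u y)" by (rule square_integrable_scale[OF dual_L2_closureD[OF u]])
  fix e :: real assume e: "0 < e"
  obtain g :: "'a \<Rightarrow>\<^sub>L real" where g: "L2_norm \<gamma> (\<lambda>y. u y - g y) < e / (\<bar>c\<bar> + 1)"
    using dual_L2_closure_approx[OF u, of "e / (\<bar>c\<bar> + 1)"] e by auto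
  have "L2_norm \<gamma> (\<lambda>y. c * u y - (c *\<^sub>R g) y) = \<bar>c\<bar> * L2_norm \<gamma> (\<lambda>y. u y - g y)"
    unfolding L2_norm_scale[symmetric] by (simp add: blinfun.bilinear_simps right_diff_distrib)
  also have "\<dots> \<le> (\<bar>c\<bar> + 1) * L2_norm \<gamma> (\<lambda>y. u y - g y)"
    by (intro mult_right_mono) (auto simp: L2_norm_nonneg)
  also have "\<dots> < e" using g by (simp add: pos_less_divide_eq mult.commute)
  finally show "\<exists>v \<in> dual_L2_closure \<gamma>. L2_norm \<gamma> (\<lambda>y. c * u y - v y) < e"
    using functional_in_dual_L2_closure by blast
qed

lemma dual_L2_closure_add:
  assumes u: "u \<in> dual_L2_closure \<gamma>" and v: "v \<in> dual_L2_closure \<gamma>"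
  shows "(\<lambda>y. u y + v y) \<in> dual_L2_closure \<gamma>"
proof (rule dual_L2_closure_limit)
  note sq = dual_L2_closureD[OF u] dual_L2_closureD[OF v]
  show "square_integrable \<gamma> (\<lambda>y. u y + v y)" by (rule square_integrable_add[OF sq])
  fix e :: real assume e: "0 < e"
  then have e2: "0 < e / 2" by simp
  obtain f g :: "'a \<Rightarrow>\<^sub>L real" where fg: "L2_norm \<gamma> (\<lambda>y. u y - f y) < e / 2" "L2_norm \<gamma> (\<lambda>y. v y - g y) < e / 2"
    using dual_L2_closure_approx[OF u e2] dual_L2_closure_approx[OF v e2] by metis
  have "L2_norm \<gamma> (\<lambda>y. (u y - f y) + (v y - g y)) < e"
    using L2_norm_triangle[OF square_integrable_diff[OF sq(1) functional_square_integrable[of f]]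
        square_integrable_diff[OF sq(2) functional_square_integrable[of g]]] fg by simp
  also have "(\<lambda>y. (u y - f y) + (v y - g y)) = (\<lambda>y. (u y + v y) - (f + g) y)"
    by (simp add: blinfun.bilinear_simps algebra_simps)
  finally show "\<exists>w \<in> dual_L2_closure \<gamma>. L2_norm \<gamma> (\<lambda>y. (u y + v y) - w y) < e"
    using functional_in_dual_L2_closure by blast
qed

text \<open>If \<open>u\<close> had positive norm, a functional \<open>g\<close> closer to
  \<open>u\<close> than that norm would give
  \<open>\<langle>u, u\<rangle> = \<langle>u, u - g\<rangle>\<close>, which Cauchy--Schwarz makes
  smaller than the squared norm of \<open>u\<close>. This is the injectivity of \<open>R_op\<close>
  modulo null functions.\<close>

lemma dual_L2_closure_orthogonal:
  assumes u: "u \<in> dual_L2_closure \<gamma>" and orth: "\<And>g :: 'a \<Rightarrow>\<^sub>L real. (LINT y|\<gamma>. u y * g y) = 0"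
  shows "L2_norm \<gamma> u = 0"
proof (rule ccontr)
  assume "L2_norm \<gamma> u \<noteq> 0"
  then have pos: "L2_norm \<gamma> u > 0" using L2_norm_nonneg[of \<gamma> u] by simp
  note sq = dual_L2_closureD[OF u]
  obtain g :: "'a \<Rightarrow>\<^sub>L real" where g: "L2_norm \<gamma> (\<lambda>y. u y - g y) < L2_norm \<gamma> u"
    using dual_L2_closure_approx[OF u pos] by blast
  have "(L2_norm \<gamma> u)\<^sup>2 = (LINT y|\<gamma>. u y * u y)"
    by (simp only: integral_mult_self)
  also have "\<dots> = (LINT y|\<gamma>. u y * (u y - g y))"
    using orth[of g] square_integrable_mult[OF sq sq] square_integrable_mult[OF sq functional_square_integrable, of g]
    by (simp add: right_diff_distrib)
  also have "\<dots> \<le> L2_norm \<gamma> u * L2_norm \<gamma> (\<lambda>y. u y - g y)"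
    using L2_Cauchy_Schwarz[OF sq square_integrable_diff[OF sq functional_square_integrable]] by (simp add: abs_le_iff)
  also have "\<dots> < L2_norm \<gamma> u * L2_norm \<gamma> u" using g pos by simp
  finally show False by (simp add: power2_eq_square)
qed

lemma L2_norm_eq_of_R_op_eq:
  assumes u: "u \<in> dual_L2_closure \<gamma>" and v: "v \<in> dual_L2_closure \<gamma>" and eq: "R_op \<gamma> u = R_op \<gamma> v"
  shows "L2_norm \<gamma> u = L2_norm \<gamma> v"
proof -
  note sq = dual_L2_closureD[OF u] dual_L2_closureD[OF v]
  have "(\<lambda>y. u y + (-1) * v y) \<in> dual_L2_closure \<gamma>"
    by (intro dual_L2_closure_add dual_L2_closure_scale u v)
  then have d: "(\<lambda>y. u y - v y) \<in> dual_L2_closure \<gamma>" by simp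
  have zero: "L2_norm \<gamma> (\<lambda>y. u y - v y) = 0"
  proof (rule dual_L2_closure_orthogonal[OF d])
    fix g :: "'a \<Rightarrow>\<^sub>L real"
    show "(LINT y|\<gamma>. (u y - v y) * g y) = 0"
      unfolding R_op_apply[OF dual_L2_closureD[OF d], symmetric] R_op_diff[OF sq] eq by simp
  qed
  have "AE y in \<gamma>. u y - v y = 0" by (rule L2_norm_eq_0_AE[OF dual_L2_closureD[OF d] zero])
  then have "(LINT y|\<gamma>. (u y)\<^sup>2) = (LINT y|\<gamma>. (v y)\<^sup>2)"
    using square_integrableD[OF sq(1)] square_integrableD[OF sq(2)] by (intro integral_cong_AE) auto
  then show ?thesis by (simp add: L2_norm_def)
qed

text \<open>The representative chosen by \<open>inv_into\<close> has the same image as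
  \<open>u\<close> and thus the same L2 norm. Minimising over the Cameron--Martin space becomes
  minimising the L2 norm of \<open>u\<close>.\<close>

lemma cameron_martin_norm_R_op:
  assumes u: "u \<in> dual_L2_closure \<gamma>"
  shows "cameron_martin_norm \<gamma> (R_op \<gamma> u) = L2_norm \<gamma> u"
proof -
  have "R_op \<gamma> u \<in> R_op \<gamma> ` dual_L2_closure \<gamma>" using u by simp
  from inv_into_into[OF this] u f_inv_into_f[OF this] show ?thesis
    unfolding cameron_martin_norm_def by (rule L2_norm_eq_of_R_op_eq)
qed

section \<open>Separating images under \<open>R_op\<close> from balls\<close>

lemma R_op_functional: "f (R_op \<gamma> (\<lambda>y. c * blinfun_apply f y)) = c * (L2_norm \<gamma> (blinfun_apply f))\<^sup>2"
  by (simp add: R_op_scale[OF functional_square_integrable] blinfun.scaleR_right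
      R_op_apply[OF functional_square_integrable] integral_mult_self)

text \<open>A functional of variance zero vanishes almost surely, whereas the nonempty open set
  where it is nonzero has positive measure.\<close>

lemma nondegenerate_functional:
  fixes f :: "'a \<Rightarrow>\<^sub>L real"
  assumes "nondegenerate_measure \<gamma>" "f y \<noteq> 0"
  shows "L2_norm \<gamma> f > 0"
proof (rule ccontr)
  assume "\<not> ?thesis"
  then have "L2_norm \<gamma> f = 0" using L2_norm_nonneg[of \<gamma> f] by simp
  then have ae: "AE y in \<gamma>. f y = 0" by (rule functional_zero_AE)
  have op: "open {y. f y \<noteq> 0}" by (intro open_Collect_neq continuous_intros)
  have "emeasure \<gamma> {y. f y \<noteq> 0} = 0"
    using ae by (subst (asm) AE_iff_measurable[OF _ refl]) (auto intro: op)
  moreover have "emeasure \<gamma> {y. f y \<noteq> 0} > 0"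
    using assms op by (auto simp: nondegenerate_measure_def topological_support_def)
  ultimately show False by simp
qed

lemma convex_R_op_translate:
  assumes "\<And>u v a b. u \<in> U \<Longrightarrow> v \<in> U \<Longrightarrow> 0 \<le> a \<Longrightarrow> 0 \<le> b \<Longrightarrow> a + b = 1 \<Longrightarrow> (\<lambda>y. a * u y + b * v y) \<in> U"
    and sq: "\<And>u. u \<in> U \<Longrightarrow> square_integrable \<gamma> u"
  shows "convex ((\<lambda>u. x - R_op \<gamma> u) ` U)"
proof (rule convexI)
  fix d e and a b :: real
  assume de: "d \<in> (\<lambda>u. x - R_op \<gamma> u) ` U" "e \<in> (\<lambda>u. x - R_op \<gamma> u) ` U" and ab: "0 \<le> a" "0 \<le> b" "a + b = 1"
  then obtain u v where uv: "u \<in> U" "v \<in> U" "d = x - R_op \<gamma> u" "e = x - R_op \<gamma> v" by auto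
  have "R_op \<gamma> (\<lambda>y. a * u y + b * v y) = a *\<^sub>R R_op \<gamma> u + b *\<^sub>R R_op \<gamma> v"
    using uv sq by (simp add: R_op_add R_op_scale square_integrable_scale)
  moreover have "a *\<^sub>R d + b *\<^sub>R e = (a + b) *\<^sub>R x - (a *\<^sub>R R_op \<gamma> u + b *\<^sub>R R_op \<gamma> v)"
    unfolding uv(3,4) by (simp add: algebra_simps)
  ultimately have "a *\<^sub>R d + b *\<^sub>R e = x - R_op \<gamma> (\<lambda>y. a * u y + b * v y)" using ab by simp
  then show "a *\<^sub>R d + b *\<^sub>R e \<in> (\<lambda>u. x - R_op \<gamma> u) ` U"
    using assms(1)[OF uv(1,2) ab] by blast
qed

text \<open>Separating the translate \<open>x - R_op \<gamma> u\<close> from the ball around the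
  origin is the same as separating the image of \<open>U\<close> from the ball around
  \<open>x\<close>. The zero function in \<open>U\<close> forces \<open>f x \<ge> r > 0\<close>, so
  \<open>f\<close> is nonzero and has positive variance.\<close>

lemma separate_R_op_image:
  assumes nd: "nondegenerate_measure \<gamma>" and r: "r > 0" and U: "U \<subseteq> dual_L2_closure \<gamma>" "(\<lambda>y. 0) \<in> U"
    and conv: "\<And>u v a b. u \<in> U \<Longrightarrow> v \<in> U \<Longrightarrow> 0 \<le> a \<Longrightarrow> 0 \<le> b \<Longrightarrow> a + b = 1 \<Longrightarrow> (\<lambda>y. a * u y + b * v y) \<in> U"
    and far: "\<And>u. u \<in> U \<Longrightarrow> r \<le> norm (x - R_op \<gamma> u)"
  obtains f :: "'a \<Rightarrow>\<^sub>L real" where "norm f \<le> 1" "L2_norm \<gamma> f > 0" "\<And>u. u \<in> U \<Longrightarrow> r + f (R_op \<gamma> u) \<le> f x"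
proof -
  obtain f :: "'a \<Rightarrow>\<^sub>L real" where f: "norm f \<le> 1" "\<And>d. d \<in> (\<lambda>u. x - R_op \<gamma> u) ` U \<Longrightarrow> r \<le> f d"
  proof (rule separate_convex_from_ball)
    show "convex ((\<lambda>u. x - R_op \<gamma> u) ` U)"
      using U(1) dual_L2_closureD by (intro convex_R_op_translate conv) auto
  qed (use U(2) far in auto)
  have le: "r \<le> f (x - R_op \<gamma> u)" if "u \<in> U" for u using f(2) that by blast
  have "f (x - R_op \<gamma> (\<lambda>y. 0)) \<noteq> 0" using le[OF U(2)] r by simp
  then have "L2_norm \<gamma> f > 0" by (rule nondegenerate_functional[OF nd])
  with f(1) le show thesis by (intro that[of f]) (auto simp: blinfun.diff_right algebra_simps)
qed

lemma zero_in_dual_L2_closure: "(\<lambda>y. 0) \<in> dual_L2_closure \<gamma>"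
proof -
  have "blinfun_apply 0 = (\<lambda>y :: 'a. 0 :: real)" by auto
  then show ?thesis using functional_in_dual_L2_closure[of 0] by simp
qed

text \<open>This is the density of the Cameron--Martin space: a separating functional would be
  bounded above on a linear space on which it does not vanish.\<close>

lemma cameron_martin_space_meets_cball:
  assumes nd: "nondegenerate_measure \<gamma>" and r: "r > 0"
  shows "\<exists>u \<in> dual_L2_closure \<gamma>. R_op \<gamma> u \<in> cball x r"
proof (rule ccontr)
  assume "\<not> ?thesis"
  then have far: "r \<le> norm (x - R_op \<gamma> u)" if "u \<in> dual_L2_closure \<gamma>" for u
    using that by (force simp: dist_norm)
  obtain f :: "'a \<Rightarrow>\<^sub>L real" where f: "L2_norm \<gamma> f > 0" "\<And>u. u \<in> dual_L2_closure \<gamma> \<Longrightarrow> r + f (R_op \<gamma> u) \<le> f x"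
    by (rule separate_R_op_image[OF nd r order_refl zero_in_dual_L2_closure _ far])
      (auto intro: dual_L2_closure_add dual_L2_closure_scale)
  \<comment> \<open>The coefficient is chosen so that \<open>f\<close> takes the value
    \<open>f x\<close> at the image, giving \<open>r + f x \<le> f x\<close>.\<close>
  have "r + f (R_op \<gamma> (\<lambda>y. f x / (L2_norm \<gamma> f)\<^sup>2 * f y)) \<le> f x"
    by (intro f(2) dual_L2_closure_scale functional_in_dual_L2_closure)
  then show False using f(1) r unfolding R_op_functional by simp
qed

lemma measure_cball_le_of_far:
  assumes nd: "nondegenerate_measure \<gamma>" and r: "r > 0" and \<rho>: "\<rho> \<ge> 0"
    and far: "\<And>u. u \<in> dual_L2_closure \<gamma> \<Longrightarrow> L2_norm \<gamma> u \<le> \<rho> \<Longrightarrow> r \<le> norm (x - R_op \<gamma> u)"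
  shows "measure \<gamma> (cball x r) \<le> exp (- (1 / 2 * \<rho>\<^sup>2)) * measure \<gamma> (cball 0 r)"
proof -
  define U where "U = {u \<in> dual_L2_closure \<gamma>. L2_norm \<gamma> u \<le> \<rho>}"
  have conv: "(\<lambda>y. a * u y + b * v y) \<in> U" if uv: "u \<in> U" "v \<in> U" and ab: "0 \<le> a" "0 \<le> b" "a + b = 1" for u v and a b :: real
  proof -
    have sq: "square_integrable \<gamma> u" "square_integrable \<gamma> v" using uv dual_L2_closureD by (auto simp: U_def)
    have "L2_norm \<gamma> (\<lambda>y. a * u y + b * v y) \<le> a * L2_norm \<gamma> u + b * L2_norm \<gamma> v"
      using L2_norm_triangle[OF square_integrable_scale[OF sq(1), of a] square_integrable_scale[OF sq(2), of b]] ab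
      by (simp add: L2_norm_scale)
    also have "\<dots> \<le> a * \<rho> + b * \<rho>" using uv ab by (intro add_mono mult_left_mono) (auto simp: U_def)
    also have "\<dots> = \<rho>" using ab by (simp flip: distrib_right)
    finally show ?thesis using uv by (auto simp: U_def intro: dual_L2_closure_add dual_L2_closure_scale)
  qed
  have U0: "U \<subseteq> dual_L2_closure \<gamma>" "(\<lambda>y. 0) \<in> U"
    using \<rho> zero_in_dual_L2_closure by (auto simp: U_def L2_norm_def)
  have Ufar: "r \<le> norm (x - R_op \<gamma> u)" if "u \<in> U" for u using that far by (auto simp: U_def)
  obtain f :: "'a \<Rightarrow>\<^sub>L real" where f: "norm f \<le> 1" "L2_norm \<gamma> f > 0" "\<And>u. u \<in> U \<Longrightarrow> r + f (R_op \<gamma> u) \<le> f x"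
    by (rule separate_R_op_image[OF nd r U0]) (blast intro: conv Ufar)+
  \<comment> \<open>The multiple of \<open>f\<close> with L2 norm \<open>\<rho>\<close> maximises
    \<open>f (R_op \<gamma> u)\<close> over \<open>U\<close>; the value is
    \<open>\<rho> * L2_norm \<gamma> f\<close>.\<close>
  have "(\<lambda>y. \<rho> / L2_norm \<gamma> f * f y) \<in> U"
    unfolding U_def
  proof (intro CollectI conjI dual_L2_closure_scale functional_in_dual_L2_closure)
    show "L2_norm \<gamma> (\<lambda>y. \<rho> / L2_norm \<gamma> f * f y) \<le> \<rho>" unfolding L2_norm_scale using f(2) \<rho> by simp
  qed
  from f(3)[OF this] have fx: "r + \<rho> * L2_norm \<gamma> f \<le> f x"
    using f(2) unfolding R_op_functional by (simp add: power2_eq_square)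
  show ?thesis
  proof (rule measure_cball_le_of_functional[OF f(2) \<rho>])
    fix y assume y: "y \<in> cball x r"
    \<comment> \<open>Since \<open>norm f \<le> 1\<close>, moving from the centre to a point of the
      ball uses up at most the margin \<open>r\<close> gained in the separation.\<close>
    have "f x - f y \<le> norm f * norm (x - y)"
      using norm_blinfun[of f "x - y"] by (simp add: blinfun.diff_right abs_le_iff)
    also have "\<dots> \<le> 1 * r" using y f(1) by (intro mult_mono) (auto simp: dist_norm)
    finally show "\<rho> * L2_norm \<gamma> f \<le> f y" using fx by simp
  qed
qed

text \<open>The minimisation takes place in L2, where the constraint set is convex because
  \<open>R_op\<close> is linear and closed because \<open>R_op\<close> is continuous.\<close>

lemma minimal_L2_norm_exists:
  assumes ne: "\<exists>u \<in> dual_L2_closure \<gamma>. R_op \<gamma> u \<in> cball x r"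
  obtains u where "u \<in> dual_L2_closure \<gamma>" "R_op \<gamma> u \<in> cball x r"
    "\<And>v. v \<in> dual_L2_closure \<gamma> \<Longrightarrow> R_op \<gamma> v \<in> cball x r \<Longrightarrow> L2_norm \<gamma> u \<le> L2_norm \<gamma> v"
proof -
  define S where "S = {u \<in> dual_L2_closure \<gamma>. R_op \<gamma> u \<in> cball x r}"
  have sqS: "square_integrable \<gamma> u" if "u \<in> S" for u using that dual_L2_closureD by (simp add: S_def)
  define m where "m = Inf (L2_norm \<gamma> ` S)"
  have Sne: "L2_norm \<gamma> ` S \<noteq> {}" using ne by (auto simp: S_def)
  have bdd: "bdd_below (L2_norm \<gamma> ` S)" by (intro bdd_belowI[of _ 0]) (auto simp: L2_norm_nonneg)
  have m_le: "m \<le> L2_norm \<gamma> u" if "u \<in> S" for u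
    unfolding m_def using that bdd by (intro cInf_lower) auto
  have m0: "0 \<le> m" unfolding m_def using Sne by (intro cInf_greatest) (auto simp: L2_norm_nonneg)
  have "\<exists>u\<in>S. L2_norm \<gamma> u < m + inverse (real (Suc n))" for n
    using cInf_less_iff[OF Sne bdd, of "m + inverse (real (Suc n))"] by (auto simp: m_def)
  then obtain u where u: "\<And>n. u n \<in> S" "\<And>n. L2_norm \<gamma> (u n) < m + inverse (real (Suc n))" by metis
  note sq = sqS[OF u(1)]
  have par: "(L2_norm \<gamma> (\<lambda>y. u i y - u j y))\<^sup>2 \<le> 2 * (L2_norm \<gamma> (u i))\<^sup>2 + 2 * (L2_norm \<gamma> (u j))\<^sup>2 - 4 * m\<^sup>2" for i j
  proof -
    \<comment> \<open>The midpoint satisfies the constraint again, so its norm is at least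
      \<open>m\<close>, and the parallelogram law bounds the difference of the two
      functions.\<close>
    let ?w = "\<lambda>y. (1/2) * (u i y + u j y)"
    have "R_op \<gamma> ?w = (1/2) *\<^sub>R R_op \<gamma> (u i) + (1/2) *\<^sub>R R_op \<gamma> (u j)"
      by (simp only: R_op_scale[OF square_integrable_add[OF sq sq]] R_op_add[OF sq sq] scaleR_add_right)
    also have "\<dots> \<in> cball x r"
      using u(1)[of i] u(1)[of j] by (intro convexD[OF convex_cball]) (auto simp: S_def)
    finally have "?w \<in> S"
      using u(1)[of i] u(1)[of j] dual_L2_closure_scale[OF dual_L2_closure_add, of "u i" "u j" "1/2"] by (auto simp: S_def)
    then have "m \<le> 1/2 * L2_norm \<gamma> (\<lambda>y. u i y + u j y)"
      using m_le[of ?w] by (simp only: L2_norm_scale) simp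
    then have "(2 * m)\<^sup>2 \<le> (L2_norm \<gamma> (\<lambda>y. u i y + u j y))\<^sup>2" using m0 by (intro power_mono) auto
    then show ?thesis
      using L2_norm_add_power2[OF sq sq, of i j] L2_norm_diff_power2[OF sq sq, of i j] by (simp add: power_mult_distrib)
  qed
  have "\<exists>N. \<forall>i\<ge>N. \<forall>j\<ge>N. L2_norm \<gamma> (\<lambda>y. u i y - u j y) \<le> e" if e: "e > 0" for e
  proof -
    \<comment> \<open>For indices from \<open>n\<close> on, \<open>par\<close> bounds the squared
      distances by this sequence, which tends to zero.\<close>
    have "(\<lambda>n. 4 * (m + inverse (real (Suc n)))\<^sup>2 - 4 * m\<^sup>2) \<longlonglongrightarrow> 4 * (m + 0)\<^sup>2 - 4 * m\<^sup>2"
      by (intro tendsto_intros LIMSEQ_inverse_real_of_nat)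
    then have "\<forall>\<^sub>F n in sequentially. 4 * (m + inverse (real (Suc n)))\<^sup>2 - 4 * m\<^sup>2 < e\<^sup>2"
      by (rule order_tendstoD) (use e in simp)
    then obtain N where N: "4 * (m + inverse (real (Suc N)))\<^sup>2 - 4 * m\<^sup>2 < e\<^sup>2"
      unfolding eventually_sequentially by blast
    have "L2_norm \<gamma> (\<lambda>y. u i y - u j y) \<le> e" if ij: "i \<ge> N" "j \<ge> N" for i j
    proof -
      have le: "(L2_norm \<gamma> (u k))\<^sup>2 \<le> (m + inverse (real (Suc N)))\<^sup>2" if "k \<ge> N" for k
      proof (rule power_mono)
        have "inverse (real (Suc k)) \<le> inverse (real (Suc N))" using that by (intro le_imp_inverse_le) auto
        then show "L2_norm \<gamma> (u k) \<le> m + inverse (real (Suc N))" using u(2)[of k] by linarith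
      qed (rule L2_norm_nonneg)
      have "(L2_norm \<gamma> (\<lambda>y. u i y - u j y))\<^sup>2 \<le> e\<^sup>2"
        using par[of i j] le[OF ij(1)] le[OF ij(2)] N by linarith
      then show ?thesis by (rule power2_le_imp_le) (use e in simp)
    qed
    then show ?thesis by blast
  qed
  from L2_complete[OF sq this]
  obtain w where w: "square_integrable \<gamma> w" "(\<lambda>n. L2_norm \<gamma> (\<lambda>y. u n y - w y)) \<longlonglongrightarrow> 0" by blast
  have "w \<in> dual_L2_closure \<gamma>"
  proof (rule dual_L2_closure_limit[OF w(1)])
    fix e :: real assume "e > 0"
    with w(2) have "\<forall>\<^sub>F n in sequentially. L2_norm \<gamma> (\<lambda>y. u n y - w y) < e" by (rule order_tendstoD)
    then obtain n where "L2_norm \<gamma> (\<lambda>y. u n y - w y) < e" unfolding eventually_sequentially by blast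
    then show "\<exists>v \<in> dual_L2_closure \<gamma>. L2_norm \<gamma> (\<lambda>y. w y - v y) < e"
      using u(1)[of n] L2_norm_minus_commute[of \<gamma> w "u n"] by (intro bexI[of _ "u n"]) (auto simp: S_def)
  qed
  moreover have "R_op \<gamma> w \<in> cball x r"
  proof (rule closed_sequentially[OF closed_cball])
    show "R_op \<gamma> (u n) \<in> cball x r" for n using u(1)[of n] by (simp add: S_def)
    obtain C where C: "\<And>v. square_integrable \<gamma> v \<Longrightarrow> norm (R_op \<gamma> v) \<le> C * L2_norm \<gamma> v"
      using R_op_bounded by blast
    have "(\<lambda>n. C * L2_norm \<gamma> (\<lambda>y. u n y - w y)) \<longlonglongrightarrow> 0"
      using tendsto_mult_right_zero[OF w(2)] by simp
    then have "(\<lambda>n. R_op \<gamma> (u n) - R_op \<gamma> w) \<longlonglongrightarrow> 0"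
    proof (rule Lim_null_comparison[rotated])
      show "\<forall>\<^sub>F n in sequentially. norm (R_op \<gamma> (u n) - R_op \<gamma> w) \<le> C * L2_norm \<gamma> (\<lambda>y. u n y - w y)"
        using C[OF square_integrable_diff[OF sq w(1)]] by (simp add: R_op_diff[OF sq w(1)])
    qed
    then show "(\<lambda>n. R_op \<gamma> (u n)) \<longlonglongrightarrow> R_op \<gamma> w" by (simp add: LIM_zero_iff)
  qed
  moreover have "L2_norm \<gamma> w \<le> m"
  proof (rule LIMSEQ_le_const)
    have "(\<lambda>n. m + inverse (real (Suc n)) + L2_norm \<gamma> (\<lambda>y. u n y - w y)) \<longlonglongrightarrow> m + 0 + 0"
      by (intro tendsto_intros LIMSEQ_inverse_real_of_nat w(2))
    then show "(\<lambda>n. m + inverse (real (Suc n)) + L2_norm \<gamma> (\<lambda>y. u n y - w y)) \<longlonglongrightarrow> m" by simp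
    have "L2_norm \<gamma> w \<le> m + inverse (real (Suc n)) + L2_norm \<gamma> (\<lambda>y. u n y - w y)" for n
      using L2_norm_triangle[OF sq square_integrable_diff[OF w(1) sq], of n n] u(2)[of n]
        L2_norm_minus_commute[of \<gamma> w "u n"] by simp
    then show "\<exists>N. \<forall>n\<ge>N. L2_norm \<gamma> w \<le> m + inverse (real (Suc n)) + L2_norm \<gamma> (\<lambda>y. u n y - w y)" by blast
  qed
  then have "L2_norm \<gamma> w \<le> L2_norm \<gamma> v" if "v \<in> dual_L2_closure \<gamma>" "R_op \<gamma> v \<in> cball x r" for v
    using m_le[of v] that by (simp add: S_def)
  ultimately show thesis using that by blast
qed

end

text \<open>The minimum is expressed through a minimiser because its existence is part of the claim.
  All minimisers give the same value, so the bound concerns the minimum itself.\<close>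

theorem proposition3p1:
  fixes \<gamma> :: "'a::{banach, second_countable_topology} measure"
    and x :: 'a and r :: real
  assumes "gaussian_measure \<gamma>"
    and "centred_measure \<gamma>"
    and "nondegenerate_measure \<gamma>"
    and "r > 0"
  shows "\<exists>h. is_arg_min (\<lambda>h. 1 / 2 * (cameron_martin_norm \<gamma> h)\<^sup>2)
               (\<lambda>h. h \<in> cameron_martin_space \<gamma> \<inter> cball x r) h \<and>
             measure \<gamma> (cball x r) / measure \<gamma> (cball 0 r)
               \<le> exp (- (1 / 2 * (cameron_martin_norm \<gamma> h)\<^sup>2))"
proof -
  interpret prob_space \<gamma> using assms(1) by (simp add: gaussian_measure_def)
  interpret centred_gaussian \<gamma> by standard (use assms in auto)
  obtain u where u: "u \<in> dual_L2_closure \<gamma>" "R_op \<gamma> u \<in> cball x r"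
    and min: "\<And>v. v \<in> dual_L2_closure \<gamma> \<Longrightarrow> R_op \<gamma> v \<in> cball x r \<Longrightarrow> L2_norm \<gamma> u \<le> L2_norm \<gamma> v"
    using minimal_L2_norm_exists[OF cameron_martin_space_meets_cball[OF assms(3,4)]] by blast
  define m where "m = L2_norm \<gamma> u"
  have m0: "0 \<le> m" by (simp add: m_def L2_norm_nonneg)
  have norm_h: "cameron_martin_norm \<gamma> (R_op \<gamma> u) = m"
    using cameron_martin_norm_R_op[OF u(1)] by (simp add: m_def)
  have "is_arg_min (\<lambda>h. 1 / 2 * (cameron_martin_norm \<gamma> h)\<^sup>2) (\<lambda>h. h \<in> cameron_martin_space \<gamma> \<inter> cball x r) (R_op \<gamma> u)"
    unfolding is_arg_min_linorder
  proof (intro conjI allI impI)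
    show "R_op \<gamma> u \<in> cameron_martin_space \<gamma> \<inter> cball x r"
      using u by (auto simp: cameron_martin_space_def)
    fix k assume "k \<in> cameron_martin_space \<gamma> \<inter> cball x r"
    then obtain v where v: "v \<in> dual_L2_closure \<gamma>" "k = R_op \<gamma> v" "R_op \<gamma> v \<in> cball x r"
      by (auto simp: cameron_martin_space_def)
    have "m \<le> cameron_martin_norm \<gamma> k"
      using min[OF v(1,3)] cameron_martin_norm_R_op[OF v(1)] v(2) by (simp add: m_def)
    then show "1 / 2 * (cameron_martin_norm \<gamma> (R_op \<gamma> u))\<^sup>2 \<le> 1 / 2 * (cameron_martin_norm \<gamma> k)\<^sup>2"
      unfolding norm_h using m0 by (simp add: power_mono)
  qed
  moreover have "measure \<gamma> (cball x r) \<le> exp (- (1 / 2 * m\<^sup>2)) * measure \<gamma> (cball 0 r)"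
  \<comment> \<open>For \<open>m = 0\<close> no nonnegative \<open>\<rho>\<close> lies below
    \<open>m\<close>, and the claim is Anderson's inequality.\<close>
  proof (cases "m = 0")
    case True
    then show ?thesis using anderson_cball[of x r] by simp
  next
    case False
    with m0 have m: "0 < m" by simp
    show ?thesis
    \<comment> \<open>For \<open>\<rho> < m\<close> the minimality of \<open>u\<close> keeps every
      image of a function of norm at most \<open>\<rho>\<close> outside the ball, so the estimate
      holds with \<open>\<rho>\<close>; it passes to \<open>m\<close> by continuity.\<close>
    proof (rule tendsto_lowerbound)
      show "((\<lambda>\<rho>. exp (- (1 / 2 * \<rho>\<^sup>2)) * measure \<gamma> (cball 0 r)) \<longlongrightarrow> exp (- (1 / 2 * m\<^sup>2)) * measure \<gamma> (cball 0 r)) (at_left m)"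
        by (intro tendsto_intros)
      show "\<forall>\<^sub>F \<rho> in at_left m. measure \<gamma> (cball x r) \<le> exp (- (1 / 2 * \<rho>\<^sup>2)) * measure \<gamma> (cball 0 r)"
        using eventually_at_left_real[OF m]
      proof eventually_elim
        case (elim \<rho>)
        show ?case
        proof (rule measure_cball_le_of_far[OF assms(3,4)])
          fix v assume v: "v \<in> dual_L2_closure \<gamma>" "L2_norm \<gamma> v \<le> \<rho>"
          then have "R_op \<gamma> v \<notin> cball x r" using min[of v] elim by (auto simp: m_def)
          then show "r \<le> norm (x - R_op \<gamma> v)" by (simp add: dist_norm)
        qed (use elim in simp)
      qed
    qed simp
  qed
  \<comment> \<open>The origin lies in the support, so the quotient is a genuine one and multiplying
    by its denominator is legitimate.\<close>
  moreover have "0 < measure \<gamma> (cball 0 r)"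
  proof -
    have "0 \<in> topological_support \<gamma>" using assms(3) by (simp add: nondegenerate_measure_def)
    then have "0 < emeasure \<gamma> (ball 0 r)"
      using assms(4) by (simp add: topological_support_def)
    also have "\<dots> \<le> emeasure \<gamma> (cball 0 r)" by (intro emeasure_mono) auto
    finally show ?thesis by (simp add: emeasure_eq_measure)
  qed
  ultimately show ?thesis
    by (intro exI[of _ "R_op \<gamma> u"]) (simp add: norm_h pos_divide_le_eq)
qed

end
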